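(* For each $n\ge p$ let $\mathbf Y=\mathbf X\boldsymbol\beta^0+\boldsymbol\epsilon$ with $\boldsymbol\epsilon\sim N_n(\mathbf 0,\sigma^2\mathbf I_n)$, $\sigma>0$ fixed and known, where $\mathbf X=\mathbf X^{(n)}$ is $n\times p$ with $\mathbf X^T\mathbf X=n\mathbf I_p$ and $\boldsymbol\beta^0=(\boldsymbol\beta^0_1,\dots,\boldsymbol\beta^0_G)$ (blocks of fixed sizes $m_g$, $p=\sum_gm_g$) does not depend on $n$. Put independent priors $\boldsymbol\beta_g\sim(1-\pi_0)N_{m_g}(\mathbf 0,\sigma^2\tau_{g,n}^2\mathbf I_{m_g})+\pi_0\delta_{\mathbf 0}(\boldsymbol\beta_g)$, $g=1,\dots,G$, with fixed $\pi_0\in(0,1)$ and fixed (non-random) $\tau^2_{g,n}>0$, and let $\hat{\boldsymbol\beta}^{Med}$ be the vector of coordinatewise marginal posterior medians, $\hat\beta^{Med}_{gj}=\mathrm{Med}(\beta_{gj}\mid\mathbf Y,\mathbf X)$. Suppose that for every $g$, $\sqrt n\,\tau^2_{g,n}\to\infty$ and $\log(\tau^2_{g,n})/n\to0$ as $n\to\infty$. Then: (i) (selection consistency) $\lim_{n\to\infty}P(\mathcal A_n^{Med}=\mathcal A)=1$; (ii) (asymptotic normality) $\sqrt n\big(\hat{\boldsymbol\beta}^{Med}_{\mathcal A}-\boldsymbol\beta^0_{\mathcal A}\big)\xrightarrow{d}N(\mathbf 0,\sigma^2\mathbf I)$.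
   Context: $\delta_{\mathbf 0}$ is a point mass at the zero vector. $\mathcal A=(I(\|\boldsymbol\beta_g^0\|_2\ne0))_{g=1}^G$ is the index vector of the true model, and $\mathcal A_n^{Med}=(I(\|\hat{\boldsymbol\beta}^{Med}_g\|_2\ne0))_{g=1}^G$ that of the model selected by the posterior median. For a vector $\mathbf v=(\mathbf v_1,\dots,\mathbf v_G)$, $\mathbf v_{\mathcal A}$ denotes the subvector consisting of the blocks $\mathbf v_g$ with $\boldsymbol\beta^0_g\neq\mathbf 0$. *)

theory Defs
  imports "HOL-Probability.Probability"
begin

text \<open>Coefficient vectors are indexed by pairs: beta g j is coordinate j of block g
  (g < G, j < m g). A design matrix is X i g j (row i, column (g,j)).\<close>

definition gauss :: "real \<Rightarrow> real \<Rightarrow> real measure" where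
  "gauss \<mu> s = density lborel (normal_density \<mu> s)"   \<comment> \<open>N(mu, s^2), s = standard deviation\<close>

definition spike_slab :: "real \<Rightarrow> nat \<Rightarrow> real \<Rightarrow> (nat \<Rightarrow> real) measure" where
  "spike_slab \<pi>0 m s =
     measure_pmf (bernoulli_pmf \<pi>0) \<bind>
       (\<lambda>b. if b then return (PiM {..<m} (\<lambda>_. lborel)) (\<lambda>j\<in>{..<m}. 0)
            else PiM {..<m} (\<lambda>_. gauss 0 s))"

definition block_prior :: "nat \<Rightarrow> (nat \<Rightarrow> nat) \<Rightarrow> real \<Rightarrow> (nat \<Rightarrow> real) \<Rightarrow> (nat \<Rightarrow> nat \<Rightarrow> real) measure" where
  "block_prior G m \<pi>0 s = PiM {..<G} (\<lambda>g. spike_slab \<pi>0 (m g) (s g))"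

definition linpred :: "(nat \<Rightarrow> nat \<Rightarrow> nat \<Rightarrow> real) \<Rightarrow> nat \<Rightarrow> (nat \<Rightarrow> nat) \<Rightarrow> (nat \<Rightarrow> nat \<Rightarrow> real) \<Rightarrow> nat \<Rightarrow> real" where
  "linpred X G m \<beta> i = (\<Sum>g<G. \<Sum>j<m g. X i g j * \<beta> g j)"

definition lik :: "nat \<Rightarrow> (nat \<Rightarrow> nat \<Rightarrow> nat \<Rightarrow> real) \<Rightarrow> nat \<Rightarrow> (nat \<Rightarrow> nat) \<Rightarrow> real \<Rightarrow> (nat \<Rightarrow> real) \<Rightarrow> (nat \<Rightarrow> nat \<Rightarrow> real) \<Rightarrow> real" where
  "lik n X G m \<sigma> y \<beta> = (\<Prod>i<n. normal_density (linpred X G m \<beta> i) \<sigma> (y i))"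

definition posterior :: "'a measure \<Rightarrow> ('a \<Rightarrow> real) \<Rightarrow> 'a measure" where
  "posterior M L = density M (\<lambda>\<theta>. ennreal (L \<theta> / (\<integral>\<theta>. L \<theta> \<partial>M)))"

definition median :: "'a measure \<Rightarrow> ('a \<Rightarrow> real) \<Rightarrow> real" where
  "median P f = Inf {t. measure P {x \<in> space P. f x \<le> t} \<ge> 1/2}"

definition post_median :: "nat \<Rightarrow> (nat \<Rightarrow> nat \<Rightarrow> nat \<Rightarrow> real) \<Rightarrow> nat \<Rightarrow> (nat \<Rightarrow> nat) \<Rightarrow> real \<Rightarrow> real
    \<Rightarrow> (nat \<Rightarrow> real) \<Rightarrow> (nat \<Rightarrow> real) \<Rightarrow> nat \<Rightarrow> nat \<Rightarrow> real" where
  "post_median n X G m \<sigma> \<pi>0 s y g j =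
     median (posterior (block_prior G m \<pi>0 s) (lik n X G m \<sigma> y)) (\<lambda>\<beta>. \<beta> g j)"

definition conv_distr :: "'i set \<Rightarrow> (nat \<Rightarrow> ('i \<Rightarrow> real) measure) \<Rightarrow> ('i \<Rightarrow> real) measure \<Rightarrow> bool" where
  "conv_distr I Ms M \<longleftrightarrow>
     (\<forall>f :: ('i \<Rightarrow> real) \<Rightarrow> real.
        continuous_on (PiE I (\<lambda>_. UNIV)) f \<and> (\<exists>B. \<forall>x\<in>PiE I (\<lambda>_. UNIV). \<bar>f x\<bar> \<le> B) \<longrightarrow>
        (\<lambda>n. \<integral>x. f x \<partial>Ms n) \<longlonglongrightarrow> (\<integral>x. f x \<partial>M))"

end

theory Submission
  imports Defs "HOL-Real_Asymp.Real_Asymp"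
begin

text \<open>Since $X^T X = n I$, the likelihood splits over the coordinates and the posterior of a block
  depends on $Y$ only through the least squares estimate $z = \beta^0 + u / \sqrt n$, where
  $u = X^T \epsilon / \sqrt n$ has law $N(0, \sigma^2 I)$ exactly, for every $n \ge p$. So the posterior median
  is an explicit function of $(n, u)$ with $u$ drawn from a law that does not change with $n$, and both claims
  follow by dominated convergence from limits at a fixed $u$: the posterior weight of the spike tends to 1
  on a zero block, which forces the median to be 0, and to 0 on a nonzero block, where the median
  then stays within $o(n^{-1/2})$ of the slab mean and hence of $z$.\<close>

text \<open>The exact law of \<open>u\<close> is rotation invariance of the product Gaussian. It is
  proved with characteristic functions on finite products, so a multivariate uniqueness theorem is
  needed; it comes from one-dimensional Levy uniqueness by induction on the coordinates. The growth
  assumptions do different jobs. Relative to the spike, each slab coordinate pays a factor 1 / sqrt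
  (1 + n tau^2). On a zero block n |z|^2 = |u|^2 does not grow, so n tau^2 tending to infinity
  already hands all weight to the spike. On a nonzero block the spike likelihood is exponentially
  small in n, and log (tau^2) / n tending to 0 keeps the price of the slab subexponential. The slab
  mean differs from z by z / (1 + n tau^2), and sqrt n tau^2 tending to infinity makes this bias
  negligible at scale 1 / sqrt n. A median is an infimum and awkward to manipulate directly. It is
  therefore accessed only through the equivalence of \<open>median \<le> c\<close> with
  \<open>1/2 \<le> F c\<close> for the distribution function F; this yields the explicit form,
  measurability and the limits.\<close>

section \<open>Uniqueness of multivariate characteristic functions\<close>

text \<open>The value at \<open>t = 0\<close> is the total mass, so both measures have the same mass
  \<open>c\<close>. Either \<open>c = 0\<close> and both vanish, or scaling by \<open>1 / c\<close>
  reduces to probability measures. Masses other than 1 occur below because measures get restricted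
  to events and reweighted.\<close>

lemma Levy_uniqueness_finite:
  fixes \<mu> \<nu> :: "real measure"
  assumes "finite_borel_measure \<mu>" "finite_borel_measure \<nu>"
    and eq: "\<And>t. (\<integral>x. iexp (t * x) \<partial>\<mu>) = (\<integral>x. iexp (t * x) \<partial>\<nu>)"
  shows "\<mu> = \<nu>"
proof -
  interpret \<mu>: finite_borel_measure \<mu> by fact
  interpret \<nu>: finite_borel_measure \<nu> by fact
  have sets: "sets \<mu> = sets borel" "sets \<nu> = sets borel"
    by (fact \<mu>.M_is_borel \<nu>.M_is_borel)+
  have space: "space \<mu> = UNIV" "space \<nu> = UNIV"
    by (fact \<mu>.borel_UNIV \<nu>.borel_UNIV)+
  define c where "c = measure \<mu> UNIV"
  have c: "measure \<mu> UNIV = c" "measure \<nu> UNIV = c"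
    using eq[of 0] by (simp_all add: c_def space)
  have em: "emeasure \<mu> UNIV = ennreal c" "emeasure \<nu> UNIV = ennreal c"
    using c \<mu>.emeasure_eq_measure[of UNIV] \<nu>.emeasure_eq_measure[of UNIV] by simp_all
  show ?thesis
  proof (cases "c = 0")
    case True
    then have "emeasure \<mu> A = 0" "emeasure \<nu> A = 0" for A
      using em emeasure_space[of \<mu> A] emeasure_space[of \<nu> A] by (simp_all add: space)
    then show ?thesis
      by (intro measure_eqI) (simp_all add: sets)
  next
    case False
    then have "c > 0" by (simp add: c_def zero_less_measure_iff)
    define \<mu>' where "\<mu>' = density \<mu> (\<lambda>_. ennreal (1 / c))"
    define \<nu>' where "\<nu>' = density \<nu> (\<lambda>_. ennreal (1 / c))"
    have real: "real_distribution \<mu>'" "real_distribution \<nu>'"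
      unfolding \<mu>'_def \<nu>'_def
      by (auto intro!: real_distribution.intro prob_spaceI simp: real_distribution_axioms_def sets space
          emeasure_density em ennreal_mult[symmetric] \<open>c > 0\<close> False less_imp_le)
    have char: "char (density \<rho> (\<lambda>_. ennreal (1 / c))) t = (1 / c) *\<^sub>R (\<integral>x. iexp (t * x) \<partial>\<rho>)"
      if "sets \<rho> = sets borel" for \<rho> t
      using that \<open>c > 0\<close> unfolding char_def
      by (subst integral_density) (auto simp: measurable_cong_sets[OF that refl])
    have "\<mu>' = \<nu>'"
      by (intro Levy_uniqueness real ext) (simp add: \<mu>'_def \<nu>'_def char sets eq del: of_real_mult)
    show ?thesis
    proof (rule measure_eqI)
      fix A assume A: "A \<in> sets \<mu>"
      have "ennreal (1 / c) * emeasure \<mu> A = ennreal (1 / c) * emeasure \<nu> A"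
        using arg_cong[OF \<open>\<mu>' = \<nu>'\<close>, of "\<lambda>M. emeasure M A"] A
        by (simp add: \<mu>'_def \<nu>'_def sets emeasure_density_const)
      then show "emeasure \<mu> A = emeasure \<nu> A"
        using \<open>c > 0\<close> by (simp add: ennreal_mult_cancel_left)
    qed (simp add: sets)
  qed
qed

lemma finite_measure_density_bounded:
  fixes w :: "'a \<Rightarrow> real"
  assumes "finite_measure M" and [measurable]: "w \<in> borel_measurable M" and "\<And>x. w x \<le> B"
  shows "finite_measure (density M w)"
proof
  interpret finite_measure M by fact
  have "emeasure (density M w) (space (density M w)) = (\<integral>\<^sup>+x. w x \<partial>M)"
    by (simp add: emeasure_density cong: nn_integral_cong_simp)
  also have "\<dots> \<le> (\<integral>\<^sup>+x. ennreal B \<partial>M)"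
    by (intro nn_integral_mono ennreal_leI assms)
  also have "\<dots> < \<top>"
    by (simp add: emeasure_eq_measure ennreal_mult_less_top)
  finally show "emeasure (density M w) (space (density M w)) \<noteq> \<infinity>"
    by simp
qed

text \<open>The two sides of \<open>eq\<close> are the characteristic functions of the images under
  \<open>u\<close> and \<open>u'\<close> of \<open>density M w\<close> and
  \<open>density N w'\<close>. Nonnegative bounded weights make these finite measures, so uniqueness
  identifies the images, and the conclusion evaluates them on \<open>S\<close>.\<close>

lemma weighted_char_eq:
  fixes u w :: "'a \<Rightarrow> real" and u' w' :: "'b \<Rightarrow> real"
  assumes "finite_measure M" "finite_measure N"
    and meas[measurable]: "u \<in> borel_measurable M" "w \<in> borel_measurable M"
      "u' \<in> borel_measurable N" "w' \<in> borel_measurable N"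
    and w: "\<And>x. 0 \<le> w x" "\<And>x. w x \<le> B" "\<And>x. 0 \<le> w' x" "\<And>x. w' x \<le> B"
    and eq: "\<And>t. (\<integral>x. w x *\<^sub>R iexp (t * u x) \<partial>M) = (\<integral>x. w' x *\<^sub>R iexp (t * u' x) \<partial>N)"
    and S[measurable]: "S \<in> sets borel"
  shows "(\<integral>x. w x * indicator S (u x) \<partial>M) = (\<integral>x. w' x * indicator S (u' x) \<partial>N)"
proof -
  have fin: "finite_measure (distr (density M w) borel u)" "finite_measure (distr (density N w') borel u')"
    by (intro finite_measure.finite_measure_distr finite_measure_density_bounded[where B=B] assms;
        simp)+
  have integral: "(\<integral>x. f x \<partial>distr (density P a) borel b) = (\<integral>x. a x *\<^sub>R f (b x) \<partial>P)"
    if [measurable]: "f \<in> borel_measurable borel" "a \<in> borel_measurable P" "b \<in> borel_measurable P"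
      and "\<And>x. 0 \<le> a x"
    for P :: "'c measure" and a b :: "'c \<Rightarrow> real" and f :: "real \<Rightarrow> 'd :: {banach, second_countable_topology}"
    using that(4) by (subst integral_distr, simp, simp, subst integral_density) simp_all
  have "distr (density M w) borel u = distr (density N w') borel u'"
  proof (rule Levy_uniqueness_finite)
    fix t
    have m: "(\<lambda>x. iexp (t * x)) \<in> borel_measurable borel" by measurable
    show "(\<integral>x. iexp (t * x) \<partial>distr (density M w) borel u) = (\<integral>x. iexp (t * x) \<partial>distr (density N w') borel u')"
      unfolding integral[OF m meas(2,1) w(1)] integral[OF m meas(4,3) w(3)] by (rule eq)
  qed (use fin in \<open>simp_all add: finite_borel_measure_def finite_borel_measure_axioms_def\<close>)
  then have "(\<integral>x. indicator S x \<partial>distr (density M w) borel u) = (\<integral>x. indicator S x \<partial>distr (density N w') borel u' :: real)"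
    by simp
  moreover have m: "(indicator S :: real \<Rightarrow> real) \<in> borel_measurable borel" by measurable
  ultimately show ?thesis
    unfolding integral[OF m meas(2,1) w(1)] integral[OF m meas(4,3) w(3)] real_scaleR_def by simp
qed

text \<open>Levy's theorem applies only to positive measures; the weights \<open>1 + cos v\<close> and \<open>1 + sin v\<close>
  recover the complex factor \<open>exp (\<i> v)\<close> from positive ones.\<close>

lemma joint_char_eq_event:
  fixes u v :: "'a \<Rightarrow> real" and u' v' :: "'b \<Rightarrow> real"
  assumes "finite_measure M" "finite_measure N"
    and meas[measurable]: "u \<in> borel_measurable M" "v \<in> borel_measurable M"
      "u' \<in> borel_measurable N" "v' \<in> borel_measurable N"
    and eq: "\<And>t r. (\<integral>x. iexp (t * u x + r * v x) \<partial>M) = (\<integral>x. iexp (t * u' x + r * v' x) \<partial>N)"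
    and S[measurable]: "S \<in> sets borel"
  shows "(\<integral>x. indicator S (u x) *\<^sub>R iexp (v x) \<partial>M) = (\<integral>x. indicator S (u' x) *\<^sub>R iexp (v' x) \<partial>N)"
proof -
  interpret M: finite_measure M by fact
  interpret N: finite_measure N by fact
  have intM: "integrable M (\<lambda>x. iexp (t * u x + r * v x))" for t r
    by (intro M.integrable_const_bound[where B=1]) auto
  have intN: "integrable N (\<lambda>x. iexp (t * u' x + r * v' x))" for t r
    by (intro N.integrable_const_bound[where B=1]) auto
  \<comment> \<open>By Euler's formula the weighted integrand is a combination of joint characters
    with \<open>r\<close> equal to 0, 1 and -1, so \<open>eq\<close> at these three values suffices.
    The shape \<open>a + r * b\<close> is kept so that the terms match \<open>eq\<close>
    literally.\<close>
  have cos: "(1 + cos b) *\<^sub>R iexp a = iexp (a + 0 * b) + (1/2) * iexp (a + 1 * b) + (1/2) * iexp (a + (-1) * b)" for a b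
    by (simp add: complex_eq_iff Re_exp Im_exp cos_add sin_add cos_diff sin_diff field_simps)
  have sin: "(1 + sin b) *\<^sub>R iexp a = iexp (a + 0 * b) + (-\<i>/2) * iexp (a + 1 * b) + (\<i>/2) * iexp (a + (-1) * b)" for a b
    by (simp add: complex_eq_iff Re_exp Im_exp cos_add sin_add cos_diff sin_diff field_simps)
  have lin: "(\<integral>x. a x + c * b x + d * e x \<partial>P) = (\<integral>x. a x \<partial>P) + c * (\<integral>x. b x \<partial>P) + d * (\<integral>x. e x \<partial>P)"
    if "integrable P a" "integrable P b" "integrable P e" for P :: "'c measure" and a b e :: "'c \<Rightarrow> complex" and c d
    using that by simp
  have 1: "(\<integral>x. 1 * indicator S (u x) \<partial>M) = (\<integral>x. 1 * indicator S (u' x) \<partial>N :: real)"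
    using eq[of _ 0] by (intro weighted_char_eq[where B=1] assms(1,2)) auto
  have c: "(\<integral>x. (1 + cos (v x)) * indicator S (u x) \<partial>M) = (\<integral>x. (1 + cos (v' x)) * indicator S (u' x) \<partial>N :: real)"
  proof (intro weighted_char_eq[where B=2] assms(1,2))
    show "(\<integral>x. (1 + cos (v x)) *\<^sub>R iexp (t * u x) \<partial>M) = (\<integral>x. (1 + cos (v' x)) *\<^sub>R iexp (t * u' x) \<partial>N)" for t
      unfolding cos lin[OF intM intM intM] lin[OF intN intN intN] eq ..
  qed (auto simp: real_0_le_add_iff)
  have s: "(\<integral>x. (1 + sin (v x)) * indicator S (u x) \<partial>M) = (\<integral>x. (1 + sin (v' x)) * indicator S (u' x) \<partial>N :: real)"
  proof (intro weighted_char_eq[where B=2] assms(1,2))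
    show "(\<integral>x. (1 + sin (v x)) *\<^sub>R iexp (t * u x) \<partial>M) = (\<integral>x. (1 + sin (v' x)) *\<^sub>R iexp (t * u' x) \<partial>N)" for t
      unfolding sin lin[OF intM intM intM] lin[OF intN intN intN] eq ..
  qed (auto simp: real_0_le_add_iff)
  have iM: "integrable M (\<lambda>x. indicator S (u x) :: real)" "integrable M (\<lambda>x. cos (v x) * indicator S (u x))"
     "integrable M (\<lambda>x. sin (v x) * indicator S (u x))"
    by (auto intro!: M.integrable_const_bound[where B=1] split: split_indicator)
  have iN: "integrable N (\<lambda>x. indicator S (u' x) :: real)" "integrable N (\<lambda>x. cos (v' x) * indicator S (u' x))"
     "integrable N (\<lambda>x. sin (v' x) * indicator S (u' x))"
    by (auto intro!: N.integrable_const_bound[where B=1] split: split_indicator)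
  have cM: "integrable M (\<lambda>x. indicator S (u x) *\<^sub>R iexp (v x))"
    by (auto intro!: M.integrable_const_bound[where B=1] split: split_indicator)
  have cN: "integrable N (\<lambda>x. indicator S (u' x) *\<^sub>R iexp (v' x))"
    by (auto intro!: N.integrable_const_bound[where B=1] split: split_indicator)
  have "(\<integral>x. cos (v x) * indicator S (u x) \<partial>M) = (\<integral>x. cos (v' x) * indicator S (u' x) \<partial>N)"
    using c 1 iM iN by (simp add: distrib_right)
  moreover have "(\<integral>x. sin (v x) * indicator S (u x) \<partial>M) = (\<integral>x. sin (v' x) * indicator S (u' x) \<partial>N)"
    using s 1 iM iN by (simp add: distrib_right)
  ultimately show ?thesis
    using integral_Re[OF cM] integral_Re[OF cN] integral_Im[OF cM] integral_Im[OF cN]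
    by (intro complex_eqI) (simp_all add: Re_exp Im_exp mult.commute)
qed

text \<open>Induction on the coordinates. To add \<open>k\<close>, restrict both measures to the
  event that \<open>x k\<close> lies in \<open>S\<close> and project to \<open>A\<close>.
  \<open>joint_char_eq_event\<close>, applied to \<open>x k\<close> and a linear form in the other
  coordinates, shows that these projections have equal characteristic functions, hence coincide by
  the induction hypothesis. With \<open>S = E k\<close> this is agreement on boxes, which generate
  the product sigma-algebra.\<close>

theorem PiM_char_eqI:
  assumes "finite A" and "finite_measure M" "finite_measure N"
    and "sets M = sets (PiM A (\<lambda>_. borel))" "sets N = sets (PiM A (\<lambda>_. borel))"
    and "\<And>s. (\<integral>x. iexp (\<Sum>k\<in>A. s k * x k) \<partial>M) = (\<integral>x. iexp (\<Sum>k\<in>A. s k * x k) \<partial>N)"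
  shows "M = N"
  using assms
proof (induction A arbitrary: M N rule: finite_induct)
  case empty
  interpret M: finite_measure M by fact
  interpret N: finite_measure N by fact
  have sp: "space M = {\<lambda>_. undefined}" "space N = {\<lambda>_. undefined}"
    using empty.prems(3,4)[THEN sets_eq_imp_space_eq] by (simp_all add: space_PiM_empty)
  \<comment> \<open>The empty linear form is 0, so the hypothesis, at an arbitrary frequency,
    compares total masses; the space is a single point.\<close>
  have "measure M (space M) = measure N (space N)"
    using empty.prems(5)[of undefined] by (simp del: of_real_sum)
  then have eq: "emeasure M {\<lambda>_. undefined} = emeasure N {\<lambda>_. undefined}"
    using M.emeasure_eq_measure N.emeasure_eq_measure by (simp add: sp)
  show ?case
  proof (rule measure_eqI)
    fix X assume "X \<in> sets M"
    then have "X \<subseteq> {\<lambda>_. undefined}" using sets.sets_into_space sp by blast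
    then have "X = {} \<or> X = {\<lambda>_. undefined}" by blast
    then show "emeasure M X = emeasure N X" using eq by auto
  qed (simp add: empty.prems)
next
  case (insert k A)
  interpret M: finite_measure M by fact
  note sets[measurable_cong] = insert.prems(3,4)
  have meas_k: "(\<lambda>x. x k) \<in> borel_measurable P"
    and meas_lin: "(\<lambda>x. \<Sum>j\<in>A. s j * x j) \<in> borel_measurable P"
    if [measurable_cong]: "sets P = sets (PiM (insert k A) (\<lambda>_. borel))" for P and s :: "'a \<Rightarrow> real"
    by (auto intro!: borel_measurable_sum borel_measurable_times simp: measurable_cong_sets[OF that refl] measurable_component_singleton)
  note meas_k = meas_k[OF insert.prems(3)] meas_k[OF insert.prems(4)]
  note meas_lin = meas_lin[OF insert.prems(3)] meas_lin[OF insert.prems(4)]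
  have char: "(\<integral>x. indicator S (x k) *\<^sub>R iexp (\<Sum>j\<in>A. s j * x j) \<partial>M)
      = (\<integral>x. indicator S (x k) *\<^sub>R iexp (\<Sum>j\<in>A. s j * x j) \<partial>N)" if "S \<in> sets borel" for S s
  proof (rule joint_char_eq_event[OF _ _ _ _ _ _ _ that])
    fix t r
    have *: "t * x k + r * (\<Sum>j\<in>A. s j * x j) = (\<Sum>j\<in>insert k A. (if j = k then t else r * s j) * x j)" for x
      using insert.hyps by (auto simp: sum_distrib_left mult.assoc intro!: sum.cong)
    show "(\<integral>x. iexp (t * x k + r * (\<Sum>j\<in>A. s j * x j)) \<partial>M) = (\<integral>x. iexp (t * x k + r * (\<Sum>j\<in>A. s j * x j)) \<partial>N)"
      unfolding * by (rule insert.prems(5))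
  qed (use insert.prems(1,2) in \<open>simp_all add: meas_k meas_lin\<close>)
  \<comment> \<open>\<open>D S P\<close> is the projection to \<open>A\<close> of \<open>P\<close>
    restricted to the event that coordinate \<open>k\<close> lies in \<open>S\<close>.\<close>
  define D where "D S P = distr (density P (\<lambda>x. ennreal (indicator S (x k)))) (PiM A (\<lambda>_. borel)) (\<lambda>x. restrict x A)"
    for S and P :: "('a \<Rightarrow> real) measure"
  have D: "D S M = D S N" if [measurable]: "S \<in> sets borel" for S
  proof (rule insert.IH)
    have "finite_measure (D S P)"
      if "finite_measure P" and [measurable_cong]: "sets P = sets (PiM (insert k A) (\<lambda>_. borel))" for P
      unfolding D_def
      by (intro finite_measure.finite_measure_distr finite_measure_density_bounded[where B=1] that)
        (auto split: split_indicator)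
    then show "finite_measure (D S M)" "finite_measure (D S N)"
      using insert.prems(1-4) by simp_all
    fix s
    have "(\<integral>x. iexp (\<Sum>j\<in>A. s j * x j) \<partial>D S P) = (\<integral>x. indicator S (x k) *\<^sub>R iexp (\<Sum>j\<in>A. s j * x j) \<partial>P)"
      if [measurable_cong]: "sets P = sets (PiM (insert k A) (\<lambda>_. borel))" for P
      unfolding D_def by (subst integral_distr, measurable, subst integral_density) (auto)
    then show "(\<integral>x. iexp (\<Sum>j\<in>A. s j * x j) \<partial>D S M) = (\<integral>x. iexp (\<Sum>j\<in>A. s j * x j) \<partial>D S N)"
      using char[OF that, of s] insert.prems(3,4) by simp
  qed (simp_all add: D_def)
  show ?case
  proof (rule measure_eqI_PiM_finite[OF _ insert.prems(3,4)])
    fix E :: "'a \<Rightarrow> real set" assume E: "\<And>i. i \<in> insert k A \<Longrightarrow> E i \<in> sets borel"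
    have [measurable]: "E k \<in> sets borel" "Pi\<^sub>E A E \<in> sets (PiM A (\<lambda>_. borel))"
      using E insert.hyps by (auto intro!: sets_PiM_I_finite)
    have "emeasure (D (E k) P) (Pi\<^sub>E A E) = emeasure P (Pi\<^sub>E (insert k A) E)"
      if [measurable_cong]: "sets P = sets (PiM (insert k A) (\<lambda>_. borel))" for P
    proof -
      have sP: "space P = PiE (insert k A) (\<lambda>_. UNIV)"
        using sets_eq_imp_space_eq[OF that] by (simp add: space_PiM)
      have m: "(\<lambda>x. restrict x A) -` Pi\<^sub>E A E \<inter> space P \<in> sets P"
        by (intro measurable_sets[of _ _ "PiM A (\<lambda>_. borel)"]) measurable
      have [measurable]: "Pi\<^sub>E (insert k A) E \<in> sets P"
        using E insert.hyps that by (auto intro!: sets_PiM_I_finite)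
      have "emeasure (D (E k) P) (Pi\<^sub>E A E)
          = (\<integral>\<^sup>+x. ennreal (indicator (E k) (x k)) * indicator ((\<lambda>x. restrict x A) -` Pi\<^sub>E A E \<inter> space P) x \<partial>P)"
        unfolding D_def using m by (subst emeasure_distr, measurable, subst emeasure_density) auto
      also have "\<dots> = (\<integral>\<^sup>+x. indicator (Pi\<^sub>E (insert k A) E) x \<partial>P)"
        by (intro nn_integral_cong) (auto simp: sP indicator_def PiE_def Pi_def extensional_def)
      finally show ?thesis by simp
    qed
    then show "emeasure M (Pi\<^sub>E (insert k A) E) = emeasure N (Pi\<^sub>E (insert k A) E)"
      using D insert.prems(3,4) by (metis \<open>E k \<in> sets borel\<close>)
  next
    show "range (\<lambda>_::nat. Pi\<^sub>E (insert k A) (\<lambda>_. UNIV :: real set)) \<subseteq> prod_algebra (insert k A) (\<lambda>_. borel)"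
      using insert.hyps by (auto intro!: prod_algebraI_finite)
  qed (use insert.hyps in \<open>auto simp: space_PiM\<close>)
qed

section \<open>Gaussian measures\<close>

lemma sets_gauss[measurable_cong, simp]: "sets (gauss \<mu> s) = sets borel"
  and space_gauss[simp]: "space (gauss \<mu> s) = UNIV"
  by (simp_all add: gauss_def)

lemma prob_space_gauss: "0 < s \<Longrightarrow> prob_space (gauss \<mu> s)"
  unfolding gauss_def by (rule prob_space_normal_density)

lemma gauss_affine:
  assumes "0 < s" "a \<noteq> 0"
  shows "distr (gauss \<mu> s) borel (\<lambda>x. b + a * x) = gauss (b + a * \<mu>) (\<bar>a\<bar> * s)"
proof -
  interpret prob_space "gauss \<mu> s" using assms(1) by (rule prob_space_gauss)
  have "distributed (gauss \<mu> s) lborel (\<lambda>x. x) (normal_density \<mu> s)"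
    by (auto simp: distributed_def gauss_def intro!: distr_id2)
  from normal_density_affine[OF this assms, of b]
  have "distr (gauss \<mu> s) lborel (\<lambda>x. b + a * x) = gauss (b + a * \<mu>) (\<bar>a\<bar> * s)"
    by (simp add: distributed_def gauss_def)
  then show ?thesis
    by (simp cong: distr_cong)
qed

lemma char_gauss:
  assumes "0 < s"
  shows "(\<integral>x. iexp (t * x) \<partial>gauss 0 s) = complex_of_real (exp (- (s\<^sup>2 * t\<^sup>2) / 2))"
proof -
  have "gauss 0 s = distr (gauss 0 1) borel (\<lambda>x. 0 + s * x)"
    using gauss_affine[of 1 s 0 0] assms by simp
  then have "(\<integral>x. iexp (t * x) \<partial>gauss 0 s) = (\<integral>x. iexp ((t * s) * x) \<partial>gauss 0 1)"
    by (simp add: integral_distr mult.assoc)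
  also have "\<dots> = char std_normal_distribution (t * s)"
    by (simp add: char_def gauss_def)
  finally show ?thesis
    by (simp add: char_std_normal_distribution power_mult_distrib mult.commute)
qed

text \<open>Independence turns the character of a sum into a product. The result depends on
  \<open>c\<close> only through its squared norm, which is the source of rotation
  invariance.\<close>

lemma char_PiM_gauss:
  assumes "0 < s" "finite I"
  shows "(\<integral>x. iexp (\<Sum>i\<in>I. c i * x i) \<partial>PiM I (\<lambda>_. gauss 0 s))
    = complex_of_real (exp (- (s\<^sup>2 * (\<Sum>i\<in>I. (c i)\<^sup>2)) / 2))"
proof -
  interpret product_prob_space "\<lambda>_. gauss 0 s" I
    using prob_space_gauss[OF assms(1)]
    by (simp add: product_prob_space_def product_prob_space_axioms_def product_sigma_finite_def prob_space_imp_sigma_finite)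
  have "(\<integral>x. iexp (\<Sum>i\<in>I. c i * x i) \<partial>PiM I (\<lambda>_. gauss 0 s)) = (\<integral>x. (\<Prod>i\<in>I. iexp (c i * x i)) \<partial>PiM I (\<lambda>_. gauss 0 s))"
    using assms(2) by (simp add: exp_sum sum_distrib_left)
  also have "\<dots> = (\<Prod>i\<in>I. \<integral>x. iexp (c i * x) \<partial>gauss 0 s)"
    by (intro product_integral_prod assms M.integrable_const_bound[where B=1]) auto
  also have "\<dots> = (\<Prod>i\<in>I. complex_of_real (exp (- (s\<^sup>2 * (c i)\<^sup>2) / 2)))"
    using assms by (simp only: char_gauss)
  also have "\<dots> = complex_of_real (exp (\<Sum>i\<in>I. - (s\<^sup>2 * (c i)\<^sup>2) / 2))"
    using assms(2) by (simp add: exp_sum)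
  finally show ?thesis
    by (simp add: sum_distrib_left sum_divide_distrib sum_negf)
qed

text \<open>Testing the image against \<open>r\<close> is testing the noise against the combination
  \<open>c\<close> of the rows with coefficients \<open>r\<close>. Orthonormality gives
  \<open>c\<close> and \<open>r\<close> the same squared norm, so the characteristic functions
  agree. The matrix need not be square: it will be the transposed design divided by sqrt n.\<close>

lemma gauss_orthonormal_image:
  fixes a :: "'k \<Rightarrow> 'i \<Rightarrow> real"
  assumes s: "0 < s" and fin: "finite I" "finite K"
    and orth: "\<And>k l. k \<in> K \<Longrightarrow> l \<in> K \<Longrightarrow> (\<Sum>i\<in>I. a k i * a l i) = (if k = l then 1 else 0)"
  shows "distr (PiM I (\<lambda>_. gauss 0 s)) (PiM K (\<lambda>_. borel)) (\<lambda>\<epsilon>. \<lambda>k\<in>K. \<Sum>i\<in>I. a k i * \<epsilon> i)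
    = PiM K (\<lambda>_. gauss 0 s)" (is "distr ?M _ ?T = ?N")
proof (rule PiM_char_eqI[OF fin(2)])
  have [measurable]: "?T \<in> measurable ?M (PiM K (\<lambda>_. borel))"
    by measurable
  interpret M: prob_space ?M by (intro prob_space_PiM prob_space_gauss s)
  interpret N: prob_space ?N by (intro prob_space_PiM prob_space_gauss s)
  show "finite_measure (distr ?M (PiM K (\<lambda>_. borel)) ?T)"
    by (intro M.finite_measure_distr) simp
  show "finite_measure ?N" by (rule N.finite_measure_axioms)
  show "sets (distr ?M (PiM K (\<lambda>_. borel)) ?T) = sets (PiM K (\<lambda>_. borel))" by simp
  show "sets ?N = sets (PiM K (\<lambda>_. borel))" by (intro sets_PiM_cong) auto
  fix r :: "'k \<Rightarrow> real"
  define c where "c i = (\<Sum>k\<in>K. r k * a k i)" for i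
  have "(\<Sum>i\<in>I. (c i)\<^sup>2) = (\<Sum>i\<in>I. \<Sum>k\<in>K. \<Sum>l\<in>K. r k * r l * (a k i * a l i))"
    by (simp add: c_def power2_eq_square sum_product ac_simps)
  also have "\<dots> = (\<Sum>k\<in>K. \<Sum>l\<in>K. r k * r l * (\<Sum>i\<in>I. a k i * a l i))"
    unfolding sum_distrib_left
    by (subst sum.swap) (intro sum.cong refl, rule sum.swap)
  also have "\<dots> = (\<Sum>k\<in>K. \<Sum>l\<in>K. if k = l then r k * r l else 0)"
    by (intro sum.cong refl) (simp add: orth)
  also have "\<dots> = (\<Sum>k\<in>K. (r k)\<^sup>2)"
    using fin by (simp add: power2_eq_square)
  finally have c: "(\<Sum>i\<in>I. (c i)\<^sup>2) = (\<Sum>k\<in>K. (r k)\<^sup>2)" .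
  have "(\<Sum>k\<in>K. r k * (\<Sum>i\<in>I. a k i * \<epsilon> i)) = (\<Sum>i\<in>I. c i * \<epsilon> i)" for \<epsilon>
    unfolding c_def sum_distrib_left sum_distrib_right by (subst sum.swap) (simp add: ac_simps)
  then have "(\<integral>x. iexp (\<Sum>k\<in>K. r k * x k) \<partial>distr ?M (PiM K (\<lambda>_. borel)) ?T) = (\<integral>\<epsilon>. iexp (\<Sum>i\<in>I. c i * \<epsilon> i) \<partial>?M)"
    by (subst integral_distr) (auto simp del: of_real_sum)
  also have "\<dots> = (\<integral>x. iexp (\<Sum>k\<in>K. r k * x k) \<partial>?N)"
    unfolding char_PiM_gauss[OF s fin(1)] char_PiM_gauss[OF s fin(2)] c ..
  finally show "(\<integral>x. iexp (\<Sum>k\<in>K. r k * x k) \<partial>distr ?M (PiM K (\<lambda>_. borel)) ?T) = (\<integral>x. iexp (\<Sum>k\<in>K. r k * x k) \<partial>?N)" .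
qed

section \<open>The standard normal distribution function\<close>

definition Phi :: "real \<Rightarrow> real" where
  "Phi t = measure (gauss 0 1) {..t}"

lemma real_distribution_gauss: "0 < s \<Longrightarrow> real_distribution (gauss \<mu> s)"
  by (simp add: real_distribution_def real_distribution_axioms_def prob_space_gauss)

lemma mono_Phi: "mono Phi"
  using real_distribution_gauss[of 1 0]
  by (auto intro!: monoI finite_measure.finite_measure_mono simp: Phi_def real_distribution_def prob_space_def)

lemma borel_measurable_Phi[measurable]: "Phi \<in> borel_measurable borel"
  by (rule borel_measurable_mono[OF mono_Phi])

lemma Phi_nonneg: "0 \<le> Phi t" and Phi_le_1: "Phi t \<le> 1"
  using prob_space.prob_le_1[OF prob_space_gauss[of 1 0]] by (simp_all add: Phi_def)

lemma measure_gauss_atMost: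
  assumes "0 < s"
  shows "measure (gauss \<mu> s) {..t} = Phi ((t - \<mu>) / s)"
proof -
  have "gauss \<mu> s = distr (gauss 0 1) borel (\<lambda>x. \<mu> + s * x)"
    using gauss_affine[of 1 s 0 \<mu>] assms by simp
  moreover have "(\<lambda>x. \<mu> + s * x) -` {..t} = {..(t - \<mu>) / s}"
    using assms by (auto simp: field_simps)
  ultimately show ?thesis
    by (simp add: measure_distr Phi_def)
qed

text \<open>Symmetry and the absence of atoms give \<open>Phi (- d) = 1 - Phi d\<close>; positivity
  of the density on the interval between gives \<open>Phi (- d) < Phi d\<close>. Together they place
  1/2 strictly between. The strictness is what later absorbs a small spike weight.\<close>

lemma Phi_pos: "0 < d \<Longrightarrow> 1/2 < Phi d" and Phi_neg: "0 < d \<Longrightarrow> Phi (- d) < 1/2"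
proof -
  assume d: "0 < d"
  interpret real_distribution "gauss 0 1" by (rule real_distribution_gauss) simp
  have "gauss 0 1 = distr (gauss 0 1) borel (\<lambda>x. 0 + (-1) * x)"
    using gauss_affine[of 1 "-1" 0 0] by simp
  then have "Phi (- d) = measure (distr (gauss 0 1) borel (\<lambda>x. 0 + (-1) * x)) {..- d}"
    by (simp add: Phi_def)
  also have "\<dots> = measure (gauss 0 1) {d..}"
    by (subst measure_distr) (auto intro!: arg_cong[where f="measure _"])
  also have "{d..} = UNIV - {..<d}" by auto
  also have "measure (gauss 0 1) (UNIV - {..<d}) = 1 - measure (gauss 0 1) {..<d}"
    using prob_compl[of "{..<d}"] by simp
  also have "measure (gauss 0 1) {..<d} = Phi d"
  proof -
    have "emeasure (gauss 0 1) {d} = 0"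
      by (simp add: gauss_def emeasure_density nn_integral_null_set null_setsI)
    then have "measure (gauss 0 1) {d} = 0" by (simp add: measure_def)
    moreover have "measure (gauss 0 1) ({..<d} \<union> {d}) = measure (gauss 0 1) {..<d} + measure (gauss 0 1) {d}"
      by (rule finite_measure_Union) auto
    moreover have "{..d} = {..<d} \<union> {d}" by auto
    ultimately show ?thesis
      by (simp only: Phi_def add_0_right)
  qed
  finally have sym: "Phi (- d) = 1 - Phi d" .
  have "measure (gauss 0 1) {-d<..d} \<noteq> 0"
  proof
    assume "measure (gauss 0 1) {-d<..d} = 0"
    then have "{-d<..d} \<in> null_sets (gauss 0 1)"
      by (simp add: null_setsI emeasure_eq_measure)
    then have "AE x in lborel. x \<in> {-d<..d} \<longrightarrow> ennreal (std_normal_density x) = 0"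
      by (subst (asm) gauss_def, subst (asm) null_sets_density_iff) auto
    then have "AE x in lborel. x \<notin> {-d<..d}"
      by eventually_elim (metis ennreal_eq_0_iff less_numeral_extra(1) linorder_not_less normal_density_pos)
    then have "emeasure lborel {-d<..d} = 0"
      by (subst (asm) AE_iff_measurable[of "{-d<..d}"]) auto
    then show False using d by simp
  qed
  moreover have "measure (gauss 0 1) {-d<..d} = Phi d - Phi (-d)"
    using d cdf_diff_eq[of "-d" d] by (simp add: cdf_def Phi_def)
  ultimately have "Phi (- d) < Phi d"
    using measure_nonneg[of "gauss 0 1" "{-d<..d}"] by linarith
  with sym show "1/2 < Phi d" "Phi (- d) < 1/2" by simp_all
qed

text \<open>Normal-normal conjugacy by completing the square in \<open>b\<close>. The last factor on
  the right is the posterior density under the slab. The prefactor is the marginal density of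
  \<open>z\<close>, which is centred normal with variance
  \<open>\<sigma>\<^sup>2 * (1 + N * v) / N\<close>, up to the constant
  \<open>sqrt (2 * pi * \<sigma>\<^sup>2 / N)\<close>.\<close>

lemma normal_conjugate:
  fixes N \<sigma> v z b :: real
  assumes "0 < N" "0 < \<sigma>" "0 < v"
  shows "exp (- N * (b - z)\<^sup>2 / (2 * \<sigma>\<^sup>2)) * normal_density 0 (\<sigma> * sqrt v) b
    = exp (- N * z\<^sup>2 / (2 * \<sigma>\<^sup>2 * (1 + N * v))) / sqrt (1 + N * v)
      * normal_density (N * v * z / (1 + N * v)) (\<sigma> * sqrt (v / (1 + N * v))) b"
proof -
  define q where "q = 1 + N * v"
  have q: "0 < q" using assms by (simp add: q_def add_pos_pos)
  have sq: "(\<sigma> * sqrt v)\<^sup>2 = \<sigma>\<^sup>2 * v" "(\<sigma> * sqrt (v / q))\<^sup>2 = \<sigma>\<^sup>2 * v / q"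
    using assms q by (simp_all add: power_mult_distrib)
  have "- N * (b - z)\<^sup>2 / (2 * \<sigma>\<^sup>2) + - b\<^sup>2 / (2 * (\<sigma>\<^sup>2 * v))
      = - (N * v * (b - z)\<^sup>2 + b\<^sup>2) / (2 * \<sigma>\<^sup>2 * v)"
    using assms by (simp add: field_simps)
  also have "N * v * (b - z)\<^sup>2 + b\<^sup>2 = N * v * z\<^sup>2 / q + q * (b - N * v * z / q)\<^sup>2"
  proof -
    \<comment> \<open>Multiplied by \<open>q\<close>, the completed square is a polynomial
      identity.\<close>
    have "q * (N * v * (b - z)\<^sup>2 + b\<^sup>2) = N * v * z\<^sup>2 + (q * b - N * v * z)\<^sup>2"
      unfolding q_def by (simp add: power2_eq_square algebra_simps)
    then have "N * v * (b - z)\<^sup>2 + b\<^sup>2 = (N * v * z\<^sup>2 + (q * b - N * v * z)\<^sup>2) / q"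
      using q by (subst eq_divide_eq) (simp add: mult.commute)
    moreover have "q * (b - N * v * z / q)\<^sup>2 = (q * b - N * v * z)\<^sup>2 / q"
      using q by (simp add: power2_eq_square field_simps)
    ultimately show ?thesis by (simp only: add_divide_distrib)
  qed
  also have "- (N * v * z\<^sup>2 / q + q * (b - N * v * z / q)\<^sup>2) / (2 * \<sigma>\<^sup>2 * v)
     = - N * z\<^sup>2 / (2 * \<sigma>\<^sup>2 * q) + - (b - N * v * z / q)\<^sup>2 / (2 * (\<sigma>\<^sup>2 * v / q))"
    using assms q by (simp add: field_simps)
  finally have e: "exp (- N * (b - z)\<^sup>2 / (2 * \<sigma>\<^sup>2)) * exp (- b\<^sup>2 / (2 * (\<sigma>\<^sup>2 * v)))
     = exp (- N * z\<^sup>2 / (2 * \<sigma>\<^sup>2 * q)) * exp (- (b - N * v * z / q)\<^sup>2 / (2 * (\<sigma>\<^sup>2 * v / q)))"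
    by (simp add: exp_add[symmetric])
  have "1 / sqrt (2 * pi * (\<sigma>\<^sup>2 * v)) = 1 / sqrt q * (1 / sqrt (2 * pi * (\<sigma>\<^sup>2 * v / q)))"
    using q by (simp add: real_sqrt_mult[symmetric])
  then show ?thesis
    using e unfolding normal_density_def q_def[symmetric] sq diff_0_right by simp
qed

lemma integral_gauss_conjugate:
  fixes N \<sigma> v z :: real
  assumes "0 < N" "0 < \<sigma>" "0 < v" and [measurable]: "S \<in> sets borel"
  shows "(\<integral>b. exp (- N * (b - z)\<^sup>2 / (2 * \<sigma>\<^sup>2)) * indicator S b \<partial>gauss 0 (\<sigma> * sqrt v))
    = exp (- N * z\<^sup>2 / (2 * \<sigma>\<^sup>2 * (1 + N * v))) / sqrt (1 + N * v)
      * measure (gauss (N * v * z / (1 + N * v)) (\<sigma> * sqrt (v / (1 + N * v)))) S"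
    (is "?I = ?D * measure ?G S")
proof -
  have "?I = (\<integral>b. exp (- N * (b - z)\<^sup>2 / (2 * \<sigma>\<^sup>2)) * normal_density 0 (\<sigma> * sqrt v) b * indicator S b \<partial>lborel)"
    unfolding gauss_def by (subst integral_density) (auto simp: ac_simps)
  also have "\<dots> = (\<integral>b. ?D * (normal_density (N * v * z / (1 + N * v)) (\<sigma> * sqrt (v / (1 + N * v))) b * indicator S b) \<partial>lborel)"
    unfolding normal_conjugate[OF assms(1-3)] by (simp only: mult.assoc)
  also have "\<dots> = ?D * (\<integral>b. indicator S b \<partial>?G)"
    unfolding gauss_def by (subst integral_density) auto
  finally show ?thesis by simp
qed

section \<open>The spike-and-slab posterior of a block\<close>

context
  fixes \<pi>0 s :: real and m :: nat
  assumes \<pi>0: "0 \<le> \<pi>0" "\<pi>0 \<le> 1" and s: "0 < s"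
begin

text \<open>The branches live on products of \<open>lborel\<close> and of \<open>gauss\<close>,
  which are different measures with one sigma-algebra; a common target over \<open>borel\<close> is
  what makes the bind well behaved.\<close>

lemma spike_slab_kernel:
  "(\<lambda>b. if b then return (PiM {..<m} (\<lambda>_. lborel)) (\<lambda>j\<in>{..<m}. 0) else PiM {..<m} (\<lambda>_. gauss 0 s))
    \<in> measurable (measure_pmf (bernoulli_pmf \<pi>0)) (subprob_algebra (PiM {..<m} (\<lambda>_. borel)))"
proof -
  have "subprob_space (PiM {..<m} (\<lambda>_. gauss 0 s))"
    by (intro prob_space_imp_subprob_space prob_space_PiM prob_space_gauss s)
  moreover have "subprob_space (return (PiM {..<m} (\<lambda>_. lborel)) (\<lambda>j\<in>{..<m}. 0 :: real))"
    by (intro prob_space_imp_subprob_space prob_space_return) (auto simp: space_PiM)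
  moreover have "sets (PiM {..<m} (\<lambda>_. lborel)) = sets (PiM {..<m} (\<lambda>_. borel :: real measure))"
    "sets (PiM {..<m} (\<lambda>_. gauss 0 s)) = sets (PiM {..<m} (\<lambda>_. borel))"
    by (intro sets_PiM_cong; simp)+
  ultimately show ?thesis
    by (simp add: space_subprob_algebra)
qed

lemma sets_spike_slab: "sets (spike_slab \<pi>0 m s) = sets (PiM {..<m} (\<lambda>_. borel))"
  unfolding spike_slab_def by (rule sets_bind_measurable[OF spike_slab_kernel]) simp

lemma prob_space_spike_slab: "prob_space (spike_slab \<pi>0 m s)"
  unfolding spike_slab_def
proof (rule prob_space.prob_space_bind[OF _ _ spike_slab_kernel])
  show "AE b in measure_pmf (bernoulli_pmf \<pi>0). prob_space
      (if b then return (PiM {..<m} (\<lambda>_. lborel)) (\<lambda>j\<in>{..<m}. 0) else PiM {..<m} (\<lambda>_. gauss 0 s))"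
    by (auto intro!: prob_space_PiM prob_space_gauss s prob_space_return simp: space_PiM)
qed (rule prob_space_measure_pmf)

text \<open>The bind is evaluated as a nonnegative integral, where it splits over the two outcomes;
  boundedness of \<open>h\<close> carries the result back to real integrals.\<close>

lemma integral_spike_slab:
  assumes [measurable]: "h \<in> borel_measurable (PiM {..<m} (\<lambda>_. borel))"
    and h: "\<And>x. 0 \<le> h x" "\<And>x. h x \<le> (B :: real)"
  shows "(\<integral>b. h b \<partial>spike_slab \<pi>0 m s)
    = \<pi>0 * h (\<lambda>j\<in>{..<m}. 0) + (1 - \<pi>0) * (\<integral>b. h b \<partial>PiM {..<m} (\<lambda>_. gauss 0 s))"
proof -
  note sets_spike_slab[measurable_cong]
  interpret S: prob_space "spike_slab \<pi>0 m s" by (rule prob_space_spike_slab)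
  interpret P: prob_space "PiM {..<m} (\<lambda>_. gauss 0 s)" by (intro prob_space_PiM prob_space_gauss s)
  have [measurable]: "h \<in> borel_measurable (PiM {..<m} (\<lambda>_. lborel))"
    using assms(1) by (simp cong: measurable_cong_sets sets_PiM_cong)
  have int: "integrable (spike_slab \<pi>0 m s) h"
    using h by (intro S.integrable_const_bound[where B=B]) auto
  have int': "integrable (PiM {..<m} (\<lambda>_. gauss 0 s)) h"
    using h by (intro P.integrable_const_bound[where B=B]) auto
  have "ennreal (\<integral>b. h b \<partial>spike_slab \<pi>0 m s) = (\<integral>\<^sup>+b. h b \<partial>spike_slab \<pi>0 m s)"
    using int h by (simp add: nn_integral_eq_integral)
  also have "\<dots> = ennreal (h (\<lambda>j\<in>{..<m}. 0)) * \<pi>0 + (\<integral>\<^sup>+b. h b \<partial>PiM {..<m} (\<lambda>_. gauss 0 s)) * (1 - \<pi>0)"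
    unfolding spike_slab_def using \<pi>0
    by (subst nn_integral_bind[OF _ spike_slab_kernel]) (auto simp: nn_integral_return space_PiM)
  also have "(\<integral>\<^sup>+b. h b \<partial>PiM {..<m} (\<lambda>_. gauss 0 s)) = ennreal (\<integral>b. h b \<partial>PiM {..<m} (\<lambda>_. gauss 0 s))"
    using int' h by (simp add: nn_integral_eq_integral)
  also have "ennreal (h (\<lambda>j\<in>{..<m}. 0)) * \<pi>0 + \<dots> * (1 - \<pi>0)
      = ennreal (\<pi>0 * h (\<lambda>j\<in>{..<m}. 0) + (1 - \<pi>0) * (\<integral>b. h b \<partial>PiM {..<m} (\<lambda>_. gauss 0 s)))"
    using \<pi>0 h by (simp add: ennreal_mult[symmetric] ennreal_plus[symmetric] integral_nonneg mult.commute
        del: ennreal_plus)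
  finally show ?thesis
    using \<pi>0 h by (subst (asm) ennreal_inj) (auto intro!: add_nonneg_nonneg mult_nonneg_nonneg integral_nonneg)
qed

lemma integral_spike_slab_prod:
  assumes [measurable]: "\<And>j. h j \<in> borel_measurable borel"
    and h: "\<And>j x. 0 \<le> h j x" "\<And>j x. h j x \<le> (1 :: real)"
  shows "(\<integral>b. (\<Prod>j<m. h j (b j)) \<partial>spike_slab \<pi>0 m s)
    = \<pi>0 * (\<Prod>j<m. h j 0) + (1 - \<pi>0) * (\<Prod>j<m. \<integral>x. h j x \<partial>gauss 0 s)"
proof -
  interpret product_prob_space "\<lambda>_. gauss 0 s" "{..<m}"
    using prob_space_gauss[OF s]
    by (simp add: product_prob_space_def product_prob_space_axioms_def product_sigma_finite_def prob_space_imp_sigma_finite)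
  have "(\<integral>b. (\<Prod>j<m. h j (b j)) \<partial>PiM {..<m} (\<lambda>_. gauss 0 s)) = (\<Prod>j<m. \<integral>x. h j x \<partial>gauss 0 s)"
  proof (intro product_integral_prod M.integrable_const_bound[where B=1])
    show "h j \<in> borel_measurable (gauss 0 s)" for j
      by measurable
  qed (use h in auto)
  moreover have "(\<lambda>b. \<Prod>j<m. h j (b j)) \<in> borel_measurable (PiM {..<m} (\<lambda>_. borel))"
    by measurable
  ultimately show ?thesis
    by (subst integral_spike_slab[where B=1]) (auto intro!: prod_nonneg prod_le_1 h)
qed

end

text \<open>Below \<open>N\<close> is the sample size, \<open>v\<close> the prior variance ratio $\tau^2$ and \<open>z\<close> the least squares estimate
  $X^T Y / n$ of a block. After division by a factor common to spike and slab, \<open>slab_factor\<close> is the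
  marginal likelihood of one coordinate under the slab.\<close>

definition slab_factor :: "real \<Rightarrow> real \<Rightarrow> real \<Rightarrow> real \<Rightarrow> real" where
  "slab_factor N \<sigma> v z = exp (- N * z\<^sup>2 / (2 * \<sigma>\<^sup>2 * (1 + N * v))) / sqrt (1 + N * v)"

definition block_evidence :: "real \<Rightarrow> nat \<Rightarrow> real \<Rightarrow> real \<Rightarrow> real \<Rightarrow> (nat \<Rightarrow> real) \<Rightarrow> real" where
  "block_evidence \<pi>0 m N \<sigma> v z = \<pi>0 * (\<Prod>j<m. exp (- N * (z j)\<^sup>2 / (2 * \<sigma>\<^sup>2)))
     + (1 - \<pi>0) * (\<Prod>j<m. slab_factor N \<sigma> v (z j))"

definition spike_weight :: "real \<Rightarrow> nat \<Rightarrow> real \<Rightarrow> real \<Rightarrow> real \<Rightarrow> (nat \<Rightarrow> real) \<Rightarrow> real" where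
  "spike_weight \<pi>0 m N \<sigma> v z =
     \<pi>0 * (\<Prod>j<m. exp (- N * (z j)\<^sup>2 / (2 * \<sigma>\<^sup>2))) / block_evidence \<pi>0 m N \<sigma> v z"

text \<open>Distribution function of the mixture of a point mass at 0 with weight \<open>l\<close>
  and a normal law N(mu, s^2) with weight \<open>1 - l\<close>, the form of the posterior marginal
  of one coordinate.\<close>

definition mixture_cdf :: "real \<Rightarrow> real \<Rightarrow> real \<Rightarrow> real \<Rightarrow> real" where
  "mixture_cdf l \<mu> s t = l * indicator {0..} t + (1 - l) * Phi ((t - \<mu>) / s)"

context
  fixes \<pi>0 N \<sigma> v :: real and m :: nat and z :: "nat \<Rightarrow> real"
  assumes \<pi>0: "0 < \<pi>0" "\<pi>0 < 1" and pos: "0 < N" "0 < \<sigma>" "0 < v"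
begin

lemma slab_factor_pos: "0 < slab_factor N \<sigma> v x"
  using pos by (simp add: slab_factor_def add_pos_pos)

text \<open>Everything comes from one computation \<open>gen\<close> with a Borel constraint
  \<open>S j\<close> on each coordinate: the spike evaluates the integrand at 0, the slab factorises
  and conjugacy applies to each factor. No constraint gives the evidence; a half-line in coordinate
  \<open>k\<close> alone gives the unnormalised marginal distribution function.\<close>

lemma integral_block_likelihood:
  "(\<integral>b. (\<Prod>j<m. exp (- N * (b j - z j)\<^sup>2 / (2 * \<sigma>\<^sup>2))) \<partial>spike_slab \<pi>0 m (\<sigma> * sqrt v))
    = block_evidence \<pi>0 m N \<sigma> v z"
  and block_evidence_pos: "0 < block_evidence \<pi>0 m N \<sigma> v z"
  and integral_block_likelihood_atMost: "k < m \<Longrightarrow>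
    (\<integral>b. (\<Prod>j<m. exp (- N * (b j - z j)\<^sup>2 / (2 * \<sigma>\<^sup>2))) * indicator {b. b k \<le> t} b
       \<partial>spike_slab \<pi>0 m (\<sigma> * sqrt v))
    = block_evidence \<pi>0 m N \<sigma> v z * mixture_cdf (spike_weight \<pi>0 m N \<sigma> v z) (N * v * z k / (1 + N * v)) (\<sigma> * sqrt (v / (1 + N * v))) t"
proof -
  let ?Z = "block_evidence \<pi>0 m N \<sigma> v z"
  show Z: "0 < ?Z"
    unfolding block_evidence_def using \<pi>0 slab_factor_pos by (intro add_pos_pos mult_pos_pos prod_pos) auto
  have gen: "(\<integral>b. (\<Prod>j<m. exp (- N * (b j - z j)\<^sup>2 / (2 * \<sigma>\<^sup>2)) * indicator (S j) (b j)) \<partial>spike_slab \<pi>0 m (\<sigma> * sqrt v))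
    = \<pi>0 * (\<Prod>j<m. exp (- N * (z j)\<^sup>2 / (2 * \<sigma>\<^sup>2)) * indicator (S j) 0)
      + (1 - \<pi>0) * (\<Prod>j<m. slab_factor N \<sigma> v (z j)
          * measure (gauss (N * v * z j / (1 + N * v)) (\<sigma> * sqrt (v / (1 + N * v)))) (S j))"
    if [measurable]: "\<And>j. S j \<in> sets borel" for S
    unfolding slab_factor_def integral_gauss_conjugate[OF pos that, symmetric] using \<pi>0 pos
    by (subst integral_spike_slab_prod[where
          h = "\<lambda>j b. exp (- N * (b - z j)\<^sup>2 / (2 * \<sigma>\<^sup>2)) * indicator (S j) b"])
      (auto split: split_indicator)
  have prob: "measure (gauss \<mu> (\<sigma> * sqrt (v / (1 + N * v)))) UNIV = 1" for \<mu>
    using prob_space.prob_space[OF prob_space_gauss[of "\<sigma> * sqrt (v / (1 + N * v))" \<mu>]] pos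
    by (simp add: add_pos_pos)
  show "(\<integral>b. (\<Prod>j<m. exp (- N * (b j - z j)\<^sup>2 / (2 * \<sigma>\<^sup>2))) \<partial>spike_slab \<pi>0 m (\<sigma> * sqrt v)) = ?Z"
    using gen[of "\<lambda>_. UNIV"] by (simp add: prob block_evidence_def)
  assume k: "k < m"
  let ?S = "\<lambda>j. if j = k then {..t} else UNIV"
  have ind: "(\<Prod>j<m. f j * (if j = k then c else 1)) = (\<Prod>j<m. f j) * c" for f :: "nat \<Rightarrow> real" and c
    using k by (simp add: prod.distrib)
  have "(\<Prod>j<m. exp (- N * (b j - z j)\<^sup>2 / (2 * \<sigma>\<^sup>2))) * indicator {b. b k \<le> t} b
     = (\<Prod>j<m. exp (- N * (b j - z j)\<^sup>2 / (2 * \<sigma>\<^sup>2)) * indicator (?S j) (b j) :: real)" for b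
    by (subst ind[symmetric]) (auto intro!: prod.cong split: split_indicator)
  then have "(\<integral>b. (\<Prod>j<m. exp (- N * (b j - z j)\<^sup>2 / (2 * \<sigma>\<^sup>2))) * indicator {b. b k \<le> t} b \<partial>spike_slab \<pi>0 m (\<sigma> * sqrt v))
    = \<pi>0 * (\<Prod>j<m. exp (- N * (z j)\<^sup>2 / (2 * \<sigma>\<^sup>2)) * indicator (?S j) 0)
      + (1 - \<pi>0) * (\<Prod>j<m. slab_factor N \<sigma> v (z j)
          * measure (gauss (N * v * z j / (1 + N * v)) (\<sigma> * sqrt (v / (1 + N * v)))) (?S j))"
    by (simp only: gen[of ?S] borel_closed closed_atMost if_split closed_UNIV simp_thms)
  also have "(\<Prod>j<m. exp (- N * (z j)\<^sup>2 / (2 * \<sigma>\<^sup>2)) * indicator (?S j) 0)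
     = (\<Prod>j<m. exp (- N * (z j)\<^sup>2 / (2 * \<sigma>\<^sup>2))) * (indicator {0..} t :: real)"
    by (subst ind[symmetric]) (auto intro!: prod.cong split: split_indicator)
  also have "(\<Prod>j<m. slab_factor N \<sigma> v (z j)
          * measure (gauss (N * v * z j / (1 + N * v)) (\<sigma> * sqrt (v / (1 + N * v)))) (?S j))
     = (\<Prod>j<m. slab_factor N \<sigma> v (z j)) * Phi ((t - N * v * z k / (1 + N * v)) / (\<sigma> * sqrt (v / (1 + N * v))))"
    using pos by (subst ind[symmetric]) (auto intro!: prod.cong simp: prob measure_gauss_atMost add_pos_pos)
  also have "\<pi>0 * ((\<Prod>j<m. exp (- N * (z j)\<^sup>2 / (2 * \<sigma>\<^sup>2))) * indicator {0..} t)
      + (1 - \<pi>0) * ((\<Prod>j<m. slab_factor N \<sigma> v (z j)) * Phi ((t - N * v * z k / (1 + N * v)) / (\<sigma> * sqrt (v / (1 + N * v)))))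
     = block_evidence \<pi>0 m N \<sigma> v z * mixture_cdf (spike_weight \<pi>0 m N \<sigma> v z) (N * v * z k / (1 + N * v)) (\<sigma> * sqrt (v / (1 + N * v))) t"
  proof -
    define E D where "E = (\<Prod>j<m. exp (- N * (z j)\<^sup>2 / (2 * \<sigma>\<^sup>2)))" and "D = (\<Prod>j<m. slab_factor N \<sigma> v (z j))"
    \<comment> \<open>Removing the spike part from the evidence \<open>Z\<close> leaves the slab
      part, so \<open>1 - spike_weight\<close> is the posterior slab probability.\<close>
    have alg: "\<pi>0 * (E * i) + (1 - \<pi>0) * (D * p) = Z * (\<pi>0 * E / Z * i + (1 - \<pi>0 * E / Z) * p)"
      if "Z = \<pi>0 * E + (1 - \<pi>0) * D" "0 < Z" for i p Z :: real
    proof -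
      have "Z * (\<pi>0 * E / Z * i + (1 - \<pi>0 * E / Z) * p) = \<pi>0 * E * i + (Z - \<pi>0 * E) * p"
        using that(2) by (simp add: field_simps)
      then show ?thesis unfolding that(1) by (simp add: algebra_simps)
    qed
    show ?thesis
      unfolding mixture_cdf_def spike_weight_def E_def[symmetric] D_def[symmetric]
      by (rule alg) (use Z in \<open>simp_all add: E_def D_def block_evidence_def\<close>)
  qed
  finally show "(\<integral>b. (\<Prod>j<m. exp (- N * (b j - z j)\<^sup>2 / (2 * \<sigma>\<^sup>2))) * indicator {b. b k \<le> t} b
       \<partial>spike_slab \<pi>0 m (\<sigma> * sqrt v))
    = block_evidence \<pi>0 m N \<sigma> v z * mixture_cdf (spike_weight \<pi>0 m N \<sigma> v z) (N * v * z k / (1 + N * v)) (\<sigma> * sqrt (v / (1 + N * v))) t" .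
qed

lemma spike_weight_nonneg: "0 \<le> spike_weight \<pi>0 m N \<sigma> v z"
  and spike_weight_le_1: "spike_weight \<pi>0 m N \<sigma> v z \<le> 1"
proof -
  have "0 \<le> \<pi>0 * (\<Prod>j<m. exp (- N * (z j)\<^sup>2 / (2 * \<sigma>\<^sup>2)))"
    using \<pi>0 by (intro mult_nonneg_nonneg prod_nonneg) auto
  moreover have "0 \<le> (1 - \<pi>0) * (\<Prod>j<m. slab_factor N \<sigma> v (z j))"
    using \<pi>0 slab_factor_pos by (intro mult_nonneg_nonneg prod_nonneg) (auto intro: less_imp_le)
  ultimately show "0 \<le> spike_weight \<pi>0 m N \<sigma> v z" "spike_weight \<pi>0 m N \<sigma> v z \<le> 1"
    using block_evidence_pos by (simp_all add: spike_weight_def divide_le_eq_1 block_evidence_def)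
qed

end

section \<open>Medians as generalised inverses of distribution functions\<close>

text \<open>The limits at both ends make the superlevel set nonempty and bounded below; monotonicity
  makes it an up-set, and right continuity lets it contain its infimum. It is thus a closed
  half-line starting at the median.\<close>

lemma Inf_superlevel_le_iff:
  fixes F :: "real \<Rightarrow> real"
  assumes mono: "mono F" and right: "\<And>c. (F \<longlongrightarrow> F c) (at_right c)"
    and top: "(F \<longlongrightarrow> 1) at_top" and bot: "(F \<longlongrightarrow> 0) at_bot"
  shows "Inf {t. 1 / 2 \<le> F t} \<le> c \<longleftrightarrow> 1 / 2 \<le> F c"
proof -
  let ?S = "{t. 1 / 2 \<le> F t}"
  have "eventually (\<lambda>t. 1 / 2 < F t) at_top"
    by (rule order_tendstoD(1)[OF top]) simp
  then obtain b where "1 / 2 < F b"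
    using eventually_happens'[OF trivial_limit_at_top_linorder] by blast
  then have b: "b \<in> ?S" by simp
  have "eventually (\<lambda>t. F t < 1 / 2) at_bot"
    by (rule order_tendstoD(2)[OF bot]) simp
  then obtain a where a: "\<And>t. t \<le> a \<Longrightarrow> F t < 1 / 2"
    by (auto simp: eventually_at_bot_linorder)
  have bdd: "bdd_below ?S"
  proof (rule bdd_belowI[of _ a])
    show "a \<le> t" if "t \<in> ?S" for t
      using a[of t] that by (cases "t \<le> a") auto
  qed
  show ?thesis
  proof
    assume "1 / 2 \<le> F c" then show "Inf ?S \<le> c"
      by (intro cInf_lower bdd) simp
  next
    assume c: "Inf ?S \<le> c"
    have "1 / 2 \<le> F t" if t: "c < t" for t
    proof -
      obtain r where r: "1 / 2 \<le> F r" "r < t"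
        using cInf_lessD[of ?S t] b c t by force
      then show ?thesis
        using monoD[OF mono, of r t] by simp
    qed
    then have "eventually (\<lambda>t. 1 / 2 \<le> F t) (at_right c)"
      by (auto simp: eventually_at_right_field intro!: exI[of _ "c + 1"])
    then show "1 / 2 \<le> F c"
      by (intro tendsto_lowerbound[OF right]) auto
  qed
qed

lemma median_le_iff:
  assumes "prob_space P" and [measurable]: "f \<in> borel_measurable P"
  shows "median P f \<le> c \<longleftrightarrow> 1 / 2 \<le> measure P {x \<in> space P. f x \<le> c}"
proof -
  interpret P: prob_space P by fact
  interpret D: real_distribution "distr P borel f"
    by (rule P.real_distribution_distr) simp
  have F: "measure P {x \<in> space P. f x \<le> t} = cdf (distr P borel f) t" for t
    by (auto simp: cdf_def measure_distr intro!: arg_cong[where f="measure P"])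
  show ?thesis
    unfolding median_def F
    using D.cdf_nondecreasing D.cdf_is_right_cont D.cdf_lim_at_top_prob D.cdf_lim_at_bot
    by (intro Inf_superlevel_le_iff) (auto intro: monoI simp: continuous_within)
qed

section \<open>The posterior for a product prior and a factorising likelihood\<close>

text \<open>Blocks stay independent a posteriori: numerator and normaliser are products of block
  integrals, so \<open>C\<close> and all blocks other than \<open>h\<close> cancel. The bounds
  \<open>L01\<close> supply integrability of every factor.\<close>

lemma
  fixes S :: "'g \<Rightarrow> 'b measure" and L :: "'g \<Rightarrow> 'b \<Rightarrow> real" and C :: real
  assumes I: "finite I" and S: "\<And>g. prob_space (S g)"
    and L[measurable]: "\<And>g. g \<in> I \<Longrightarrow> L g \<in> borel_measurable (S g)"
    and L01: "\<And>g b. 0 \<le> L g b" "\<And>g b. L g b \<le> 1"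
    and Z: "\<And>g. g \<in> I \<Longrightarrow> 0 < (\<integral>b. L g b \<partial>S g)"
    and C: "0 < C" and f: "\<And>\<beta>. f \<beta> = C * (\<Prod>g\<in>I. L g (\<beta> g))"
  shows prob_space_posterior_PiM: "prob_space (posterior (PiM I S) f)" (is ?prob)
    and measure_posterior_PiM: "h \<in> I \<Longrightarrow> E \<in> sets (S h) \<Longrightarrow>
      measure (posterior (PiM I S) f) {\<beta> \<in> space (posterior (PiM I S) f). \<beta> h \<in> E}
      = (\<integral>b. L h b * indicator E b \<partial>S h) / (\<integral>b. L h b \<partial>S h)"
proof -
  interpret P: prob_space "PiM I S" by (intro prob_space_PiM S)
  interpret S: product_prob_space S I
    using S by (simp add: product_prob_space_def product_prob_space_axioms_def product_sigma_finite_def prob_space_imp_sigma_finite)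
  have prod: "(\<integral>\<beta>. (\<Prod>g\<in>I. H g (\<beta> g)) \<partial>PiM I S) = (\<Prod>g\<in>I. \<integral>b. H g b \<partial>S g)"
    if "\<And>g. g \<in> I \<Longrightarrow> H g \<in> borel_measurable (S g)" "\<And>g b. 0 \<le> H g b" "\<And>g b. H g b \<le> 1"
    for H :: "'g \<Rightarrow> 'b \<Rightarrow> real"
  proof (intro S.product_integral_prod I)
    fix g assume "g \<in> I"
    show "integrable (S g) (H g)"
      using that \<open>g \<in> I\<close> by (intro S.M.integrable_const_bound[where B=1]) auto
  qed
  define W where "W = (\<integral>\<beta>. f \<beta> \<partial>PiM I S)"
  have W: "W = C * (\<Prod>g\<in>I. \<integral>b. L g b \<partial>S g)"
    unfolding W_def f using prod[of L] L L01 by simp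
  then have "0 < W" using C Z by (simp add: prod_pos)
  have lik_nonneg: "0 \<le> f \<beta>" and lik_le: "f \<beta> \<le> C" for \<beta>
    using C by (auto simp: f intro!: mult_nonneg_nonneg prod_nonneg L01 mult_left_le prod_le_1)
  have [measurable]: "f \<in> borel_measurable (PiM I S)"
    unfolding f[abs_def] by measurable
  have int: "integrable (PiM I S) f"
    using lik_nonneg lik_le by (intro P.integrable_const_bound[where B=C]) auto
  have em: "emeasure (posterior (PiM I S) f) A = ennreal ((\<integral>\<beta>. f \<beta> * indicator A \<beta> \<partial>PiM I S) / W)"
    if [measurable]: "A \<in> sets (PiM I S)" for A
  proof -
    have "integrable (PiM I S) (\<lambda>\<beta>. f \<beta> / W * indicator A \<beta>)"
      using int by (intro integrable_real_mult_indicator integrable_divide) auto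
    then have "(\<integral>\<^sup>+\<beta>. ennreal (f \<beta> / W * indicator A \<beta>) \<partial>PiM I S) = ennreal (\<integral>\<beta>. f \<beta> / W * indicator A \<beta> \<partial>PiM I S)"
      using lik_nonneg \<open>0 < W\<close> by (intro nn_integral_eq_integral) auto
    moreover have "emeasure (posterior (PiM I S) f) A = (\<integral>\<^sup>+\<beta>. ennreal (f \<beta> / W * indicator A \<beta>) \<partial>PiM I S)"
      unfolding posterior_def W_def[symmetric]
      by (subst emeasure_density) (auto intro!: nn_integral_cong split: split_indicator)
    ultimately show ?thesis by simp
  qed
  have space: "space (posterior (PiM I S) f) = space (PiM I S)"
    by (simp add: posterior_def)
  have "(\<integral>\<beta>. f \<beta> * indicator (space (PiM I S)) \<beta> \<partial>PiM I S) = W"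
    unfolding W_def by (intro Bochner_Integration.integral_cong) auto
  then show ?prob
    using em[of "space (PiM I S)"] \<open>0 < W\<close> by (intro prob_spaceI) (simp add: space)
  assume h: "h \<in> I" and E[measurable]: "E \<in> sets (S h)"
  let ?A = "{\<beta> \<in> space (PiM I S). \<beta> h \<in> E}"
  \<comment> \<open>The indicator is attached to factor \<open>h\<close> alone, so that the integral
    over the event is again an integral of a product.\<close>
  let ?H = "\<lambda>g b. L g b * (if g = h then indicator E b else 1)"
  have [measurable]: "?A \<in> sets (PiM I S)" using h by measurable
  have "(\<integral>\<beta>. f \<beta> * indicator ?A \<beta> \<partial>PiM I S) = (\<integral>\<beta>. C * (\<Prod>g\<in>I. ?H g (\<beta> g)) \<partial>PiM I S)"
  proof (intro Bochner_Integration.integral_cong refl)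
    fix \<beta> assume "\<beta> \<in> space (PiM I S)"
    then have "indicator ?A \<beta> = (indicator E (\<beta> h) :: real)"
      by (simp split: split_indicator)
    also have "\<dots> = (\<Prod>g\<in>I. if g = h then indicator E (\<beta> g) else 1)"
      using I h by simp
    finally show "f \<beta> * indicator ?A \<beta> = C * (\<Prod>g\<in>I. ?H g (\<beta> g))"
      by (simp only: f prod.distrib mult.assoc)
  qed
  also have "\<dots> = C * (\<Prod>g\<in>I. \<integral>b. ?H g b \<partial>S g)"
  proof -
    have "?H g \<in> borel_measurable (S g)" if [simp]: "g \<in> I" for g
      using h by (cases "g = h") (auto intro!: borel_measurable_times L)
    then show ?thesis
      using prod[of ?H] L01 by (simp add: mult_le_one)
  qed
  also have "(\<Prod>g\<in>I. \<integral>b. ?H g b \<partial>S g)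
      = (\<integral>b. L h b * indicator E b \<partial>S h) * (\<Prod>g\<in>I - {h}. \<integral>b. L g b \<partial>S g)"
    using I h by (subst prod.remove[of I h]) (auto intro!: prod.cong)
  also have "C * \<dots> = (\<integral>b. L h b * indicator E b \<partial>S h) / (\<integral>b. L h b \<partial>S h) * W"
  proof -
    have "(\<Prod>g\<in>I. \<integral>b. L g b \<partial>S g) = (\<integral>b. L h b \<partial>S h) * (\<Prod>g\<in>I - {h}. \<integral>b. L g b \<partial>S g)"
      using I h by (rule prod.remove)
    then show ?thesis
      unfolding W using Z[OF h] by simp
  qed
  finally have eq: "(\<integral>\<beta>. f \<beta> * indicator ?A \<beta> \<partial>PiM I S) / W
      = (\<integral>b. L h b * indicator E b \<partial>S h) / (\<integral>b. L h b \<partial>S h)"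
    using \<open>0 < W\<close> by simp
  have "0 \<le> (\<integral>b. L h b * indicator E b \<partial>S h) / (\<integral>b. L h b \<partial>S h)"
    using L01 Z[OF h] by (intro divide_nonneg_pos integral_nonneg) auto
  then show "measure (posterior (PiM I S) f) {\<beta> \<in> space (posterior (PiM I S) f). \<beta> h \<in> E}
      = (\<integral>b. L h b * indicator E b \<partial>S h) / (\<integral>b. L h b \<partial>S h)"
    using em[of ?A] by (simp add: eq space measure_def)
qed

text \<open>Pythagoras with Gram matrix n I: the fitted values have squared length n |b|^2 and inner
  product n b.z with \<open>y\<close>, and completing the square leaves \<open>b\<close> in one
  separate term per coordinate.\<close>

lemma residual_sum_orthogonal:
  fixes x :: "nat \<Rightarrow> 'k \<Rightarrow> real"
  assumes K: "finite K" and n: "0 < n"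
    and orth: "\<And>k l. k \<in> K \<Longrightarrow> l \<in> K \<Longrightarrow> (\<Sum>i<n. x i k * x i l) = (if k = l then real n else 0)"
    and z: "\<And>k. z k = (\<Sum>i<n. x i k * y i) / n"
  shows "(\<Sum>i<n. (y i - (\<Sum>k\<in>K. x i k * b k))\<^sup>2)
    = (\<Sum>i<n. (y i)\<^sup>2) - (\<Sum>k\<in>K. n * (z k)\<^sup>2) + (\<Sum>k\<in>K. n * (b k - z k)\<^sup>2)"
proof -
  have "(\<Sum>i<n. (\<Sum>k\<in>K. x i k * b k)\<^sup>2) = (\<Sum>i<n. \<Sum>k\<in>K. \<Sum>l\<in>K. b k * b l * (x i k * x i l))"
    by (simp add: power2_eq_square sum_product ac_simps)
  also have "\<dots> = (\<Sum>k\<in>K. \<Sum>l\<in>K. b k * b l * (\<Sum>i<n. x i k * x i l))"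
    unfolding sum_distrib_left by (subst sum.swap) (intro sum.cong refl, rule sum.swap)
  also have "\<dots> = (\<Sum>k\<in>K. \<Sum>l\<in>K. if k = l then n * (b k * b l) else 0)"
    by (intro sum.cong refl) (simp add: orth)
  also have "\<dots> = (\<Sum>k\<in>K. n * (b k)\<^sup>2)"
    using K by (simp add: power2_eq_square)
  finally have 1: "(\<Sum>i<n. (\<Sum>k\<in>K. x i k * b k)\<^sup>2) = (\<Sum>k\<in>K. n * (b k)\<^sup>2)" .
  have "(\<Sum>i<n. y i * (\<Sum>k\<in>K. x i k * b k)) = (\<Sum>k\<in>K. b k * (\<Sum>i<n. x i k * y i))"
    unfolding sum_distrib_left by (subst sum.swap) (simp add: ac_simps)
  also have "\<dots> = (\<Sum>k\<in>K. n * (b k * z k))"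
    using n by (intro sum.cong) (simp_all add: z)
  finally have 2: "(\<Sum>i<n. y i * (\<Sum>k\<in>K. x i k * b k)) = (\<Sum>k\<in>K. n * (b k * z k))" .
  have "(\<Sum>i<n. (y i - (\<Sum>k\<in>K. x i k * b k))\<^sup>2)
      = (\<Sum>i<n. (y i)\<^sup>2) + (\<Sum>i<n. (\<Sum>k\<in>K. x i k * b k)\<^sup>2) - 2 * (\<Sum>i<n. y i * (\<Sum>k\<in>K. x i k * b k))"
    by (simp add: power2_diff sum.distrib sum_subtractf sum_distrib_left mult.assoc)
  also have "\<dots> = (\<Sum>i<n. (y i)\<^sup>2) - (\<Sum>k\<in>K. n * (z k)\<^sup>2) + (\<Sum>k\<in>K. n * (b k - z k)\<^sup>2)"
    unfolding 1 2
    by (simp add: power2_diff sum.distrib sum_subtractf sum_distrib_left algebra_simps)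
  finally show ?thesis .
qed

text \<open>\<open>C\<close> may depend on \<open>y\<close> but not on \<open>\<beta>\<close>, so it
  cancels in the posterior. The remaining factors are at most 1, as the product posterior lemmas
  require.\<close>

lemma lik_factorization:
  assumes \<sigma>: "0 < \<sigma>" and n: "0 < n"
    and orth: "\<forall>g<G. \<forall>j<m g. \<forall>g'<G. \<forall>j'<m g'.
      (\<Sum>i<n. X i g j * X i g' j') = (if g = g' \<and> j = j' then real n else 0)"
    and z: "\<And>g j. z g j = (\<Sum>i<n. X i g j * y i) / n"
  obtains C where "0 < C"
    "\<And>\<beta>. lik n X G m \<sigma> y \<beta> = C * (\<Prod>g<G. \<Prod>j<m g. exp (- real n * (\<beta> g j - z g j)\<^sup>2 / (2 * \<sigma>\<^sup>2)))"
proof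
  define K where "K = Sigma {..<G} (\<lambda>g. {..<m g})"
  \<comment> \<open>The residual sum of squares of the least squares fit.\<close>
  define Q where "Q = (\<Sum>i<n. (y i)\<^sup>2) - (\<Sum>k\<in>K. n * (z (fst k) (snd k))\<^sup>2)"
  define C where "C = (1 / sqrt (2 * pi * \<sigma>\<^sup>2)) ^ n * exp (- Q / (2 * \<sigma>\<^sup>2))"
  show "0 < C" using \<sigma> by (simp add: C_def)
  have fin: "finite K" by (simp add: K_def)
  fix \<beta>
  have lin: "linpred X G m \<beta> i = (\<Sum>k\<in>K. X i (fst k) (snd k) * \<beta> (fst k) (snd k))" for i
    by (simp add: linpred_def K_def sum.Sigma split_def)
  have orthK: "(\<Sum>i<n. X i (fst k) (snd k) * X i (fst l) (snd l)) = (if k = l then real n else 0)"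
    if "k \<in> K" "l \<in> K" for k l
    using that orth by (auto simp: K_def prod_eq_iff)
  have "lik n X G m \<sigma> y \<beta> = (1 / sqrt (2 * pi * \<sigma>\<^sup>2)) ^ n * exp (\<Sum>i<n. - (y i - linpred X G m \<beta> i)\<^sup>2 / (2 * \<sigma>\<^sup>2))"
    unfolding lik_def normal_density_def by (simp add: prod.distrib exp_sum power_divide prod_dividef)
  also have "(\<Sum>i<n. - (y i - linpred X G m \<beta> i)\<^sup>2 / (2 * \<sigma>\<^sup>2)) = - (\<Sum>i<n. (y i - linpred X G m \<beta> i)\<^sup>2) / (2 * \<sigma>\<^sup>2)"
    by (simp add: sum_negf sum_divide_distrib)
  also have "\<dots> = - Q / (2 * \<sigma>\<^sup>2) + (\<Sum>k\<in>K. - real n * (\<beta> (fst k) (snd k) - z (fst k) (snd k))\<^sup>2 / (2 * \<sigma>\<^sup>2))"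
    unfolding lin Q_def
    by (subst residual_sum_orthogonal[OF fin n orthK, where z="\<lambda>k. z (fst k) (snd k)"])
      (simp_all add: z sum_negf sum_divide_distrib[symmetric] diff_divide_distrib add_divide_distrib)
  finally show "lik n X G m \<sigma> y \<beta> = C * (\<Prod>g<G. \<Prod>j<m g. exp (- real n * (\<beta> g j - z g j)\<^sup>2 / (2 * \<sigma>\<^sup>2)))"
    unfolding exp_add exp_sum[OF fin] C_def by (simp add: K_def prod.Sigma split_def)
qed

lemma post_median_le_iff:
  assumes \<sigma>: "0 < \<sigma>" and \<pi>0: "0 < \<pi>0" "\<pi>0 < 1" and n: "0 < n" and v: "\<forall>g<G. 0 < v g"
    and orth: "\<forall>g<G. \<forall>j<m g. \<forall>g'<G. \<forall>j'<m g'.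
      (\<Sum>i<n. X i g j * X i g' j') = (if g = g' \<and> j = j' then real n else 0)"
    and z: "\<And>g j. z g j = (\<Sum>i<n. X i g j * y i) / n"
    and g: "g < G" and j: "j < m g"
  shows "post_median n X G m \<sigma> \<pi>0 (\<lambda>g. \<sigma> * sqrt (v g)) y g j \<le> c \<longleftrightarrow>
    1 / 2 \<le> mixture_cdf (spike_weight \<pi>0 (m g) n \<sigma> (v g) (z g))
      (n * v g * z g j / (1 + n * v g)) (\<sigma> * sqrt (v g / (1 + n * v g))) c"
proof -
  obtain C where C: "0 < C"
    "\<And>\<beta>. lik n X G m \<sigma> y \<beta> = C * (\<Prod>g<G. \<Prod>j<m g. exp (- real n * (\<beta> g j - z g j)\<^sup>2 / (2 * \<sigma>\<^sup>2)))"
    using lik_factorization[OF \<sigma> n orth z] by blast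
  \<comment> \<open>The default 1 outside \<open>g < G\<close> makes every \<open>S g\<close> a
    probability space, as the product lemmas ask for all indices; the prior involves only
    \<open>g < G\<close>.\<close>
  define s where "s g = \<sigma> * sqrt (if g < G then v g else 1)" for g
  define S where "S g = spike_slab \<pi>0 (m g) (s g)" for g
  define L where "L g b = (\<Prod>j<m g. exp (- real n * (b j - z g j)\<^sup>2 / (2 * \<sigma>\<^sup>2)))" for g and b :: "nat \<Rightarrow> real"
  have s: "0 < s g" for g using \<sigma> v by (simp add: s_def)
  have prior: "block_prior G m \<pi>0 (\<lambda>g. \<sigma> * sqrt (v g)) = PiM {..<G} S"
    unfolding block_prior_def by (intro PiM_cong) (auto simp: S_def s_def)
  have S: "prob_space (S g)" and sets_S[measurable_cong]: "sets (S g) = sets (PiM {..<m g} (\<lambda>_. borel))" for g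
    unfolding S_def using \<pi>0 s by (simp_all add: prob_space_spike_slab sets_spike_slab less_imp_le)
  have L: "L g \<in> borel_measurable (S g)" "0 \<le> L g b" "L g b \<le> 1" for g b
    unfolding L_def by (measurable, auto intro!: prod_nonneg prod_le_1)
  have Z: "(\<integral>b. L g b \<partial>S g) = block_evidence \<pi>0 (m g) n \<sigma> (v g) (z g)" if "g < G" for g
    using that \<pi>0 \<sigma> n v unfolding L_def S_def s_def by (simp only: if_True integral_block_likelihood of_nat_0_less_iff)
  have Zpos: "0 < block_evidence \<pi>0 (m g) n \<sigma> (v g) (z g)" if "g < G" for g
    using that \<pi>0 \<sigma> n v by (intro block_evidence_pos) auto
  let ?P = "posterior (PiM {..<G} S) (lik n X G m \<sigma> y)"
  have post: "prob_space ?P"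
    by (rule prob_space_posterior_PiM[where L=L and C=C])
      (use S L Z Zpos C in \<open>auto simp: L_def\<close>)
  have comp: "(\<lambda>b. b j) \<in> borel_measurable (S g)"
    using j by (simp add: measurable_cong_sets[OF sets_S refl] measurable_component_singleton)
  have E[measurable]: "{b \<in> space (S g). b j \<le> c} \<in> sets (S g)" for c
    using comp by measurable
  have "measure ?P {\<beta> \<in> space ?P. \<beta> g j \<le> c}
    = mixture_cdf (spike_weight \<pi>0 (m g) n \<sigma> (v g) (z g))
      (n * v g * z g j / (1 + n * v g)) (\<sigma> * sqrt (v g / (1 + n * v g))) c" for c
  proof -
    have "measure ?P {\<beta> \<in> space ?P. \<beta> g \<in> {b \<in> space (S g). b j \<le> c}}
        = (\<integral>b. L g b * indicator {b \<in> space (S g). b j \<le> c} b \<partial>S g) / (\<integral>b. L g b \<partial>S g)"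
      by (rule measure_posterior_PiM[where L=L and C=C])
        (use S L Z Zpos C g E in \<open>auto simp: L_def\<close>)
    also have "(\<integral>b. L g b * indicator {b \<in> space (S g). b j \<le> c} b \<partial>S g) = (\<integral>b. L g b * indicator {b. b j \<le> c} b \<partial>S g)"
      by (intro Bochner_Integration.integral_cong) (auto split: split_indicator)
    also have "\<dots> = block_evidence \<pi>0 (m g) n \<sigma> (v g) (z g)
        * mixture_cdf (spike_weight \<pi>0 (m g) n \<sigma> (v g) (z g))
        (n * v g * z g j / (1 + n * v g)) (\<sigma> * sqrt (v g / (1 + n * v g))) c"
      unfolding L_def S_def s_def using g j \<pi>0 \<sigma> n v by (simp only: if_True integral_block_likelihood_atMost of_nat_0_less_iff)
    also have "{\<beta> \<in> space ?P. \<beta> g \<in> {b \<in> space (S g). b j \<le> c}} = {\<beta> \<in> space ?P. \<beta> g j \<le> c}"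
      using g by (auto simp: posterior_def space_PiM)
    finally show "measure ?P {\<beta> \<in> space ?P. \<beta> g j \<le> c}
      = mixture_cdf (spike_weight \<pi>0 (m g) n \<sigma> (v g) (z g))
        (n * v g * z g j / (1 + n * v g)) (\<sigma> * sqrt (v g / (1 + n * v g))) c"
      using Zpos[OF g] by (simp add: Z[OF g])
  qed
  moreover have "(\<lambda>\<beta>. \<beta> g j) \<in> borel_measurable ?P"
    unfolding posterior_def measurable_density_eq1
    using g by (intro measurable_compose[OF _ comp] measurable_component_singleton) simp
  ultimately show ?thesis
    unfolding post_median_def prior by (simp add: median_le_iff[OF post])
qed

section \<open>Limits of the posterior median\<close>

definition mixture_median :: "real \<Rightarrow> real \<Rightarrow> real \<Rightarrow> real" where
  "mixture_median l \<mu> s = Inf {t. 1 / 2 \<le> mixture_cdf l \<mu> s t}"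

lemma mixture_median_le_iff:
  assumes l: "0 \<le> l" "l \<le> 1" and s: "0 < s"
  shows "mixture_median l \<mu> s \<le> c \<longleftrightarrow> 1 / 2 \<le> mixture_cdf l \<mu> s c"
  unfolding mixture_median_def
proof (rule Inf_superlevel_le_iff)
  interpret D: real_distribution "gauss \<mu> s" by (rule real_distribution_gauss[OF s])
  have F: "mixture_cdf l \<mu> s = (\<lambda>t. l * indicator {0..} t + (1 - l) * cdf (gauss \<mu> s) t)"
    by (simp add: mixture_cdf_def fun_eq_iff cdf_def measure_gauss_atMost[OF s])
  show "mono (mixture_cdf l \<mu> s)"
    unfolding F using l D.cdf_nondecreasing
    by (intro monoI add_mono mult_left_mono) (auto split: split_indicator)
  fix c :: real
  \<comment> \<open>The half-line is closed, so its indicator is constant immediately to the right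
    of every point, including the jump at 0.\<close>
  have "eventually (\<lambda>t. indicator {0..} t = (indicator {0..} c :: real)) (at_right c)"
  proof (cases "c < 0")
    case True
    then have "eventually (\<lambda>t. t < 0) (at_right c)"
      by (auto simp: eventually_at_right_field)
    then show ?thesis
      by (rule eventually_mono) (use True in auto)
  qed (auto simp: eventually_at_right_field intro!: exI[of _ "c + 1"])
  then have "((\<lambda>t. indicator {0..} t :: real) \<longlongrightarrow> indicator {0..} c) (at_right c)"
    by (rule tendsto_eventually)
  then show "(mixture_cdf l \<mu> s \<longlongrightarrow> mixture_cdf l \<mu> s c) (at_right c)"
    unfolding F using D.cdf_is_right_cont[of c]
    by (intro tendsto_intros) (simp_all add: continuous_within)
next
  interpret D: real_distribution "gauss \<mu> s" by (rule real_distribution_gauss[OF s])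
  have F: "mixture_cdf l \<mu> s = (\<lambda>t. l * indicator {0..} t + (1 - l) * cdf (gauss \<mu> s) t)"
    by (simp add: mixture_cdf_def fun_eq_iff cdf_def measure_gauss_atMost[OF s])
  have "((\<lambda>t::real. indicator {0..} t :: real) \<longlongrightarrow> 1) at_top"
    by (rule tendsto_eventually, rule eventually_at_top_linorderI[of 0]) simp
  then have "(mixture_cdf l \<mu> s \<longlongrightarrow> l * 1 + (1 - l) * 1) at_top"
    unfolding F by (intro tendsto_intros D.cdf_lim_at_top_prob)
  then show "(mixture_cdf l \<mu> s \<longlongrightarrow> 1) at_top" by simp
  have "((\<lambda>t::real. indicator {0..} t :: real) \<longlongrightarrow> 0) at_bot"
    by (rule tendsto_eventually, rule eventually_at_bot_linorderI[of "-1"]) simp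
  then have "(mixture_cdf l \<mu> s \<longlongrightarrow> l * 0 + (1 - l) * 0) at_bot"
    unfolding F by (intro tendsto_intros D.cdf_lim_at_bot)
  then show "(mixture_cdf l \<mu> s \<longlongrightarrow> 0) at_bot" by simp
qed

text \<open>An atom heavier than 1/2 forces the median: below 0 the distribution function is at most
  \<open>1 - l\<close>, less than 1/2, and at 0 it is at least \<open>l\<close>. Exact zeros, hence
  model selection, come from here, whatever the slab looks like.\<close>

lemma mixture_median_eq_0:
  assumes "1 / 2 < l" "l \<le> 1" "0 < s"
  shows "mixture_median l \<mu> s = 0"
proof -
  note iff = mixture_median_le_iff[of l s \<mu>]
  have "1 / 2 \<le> mixture_cdf l \<mu> s 0"
    using assms Phi_nonneg[of "(0 - \<mu>) / s"]
    by (simp add: mixture_cdf_def add_increasing2)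
  then have "mixture_median l \<mu> s \<le> 0"
    using iff assms by simp
  moreover have "\<not> mixture_median l \<mu> s < 0"
  proof
    assume neg: "mixture_median l \<mu> s < 0"
    let ?t = "(mixture_median l \<mu> s - \<mu>) / s"
    have "(1 - l) * Phi ?t \<le> (1 - l) * 1"
      using assms Phi_le_1 by (intro mult_left_mono) auto
    moreover have "1 / 2 \<le> mixture_cdf l \<mu> s (mixture_median l \<mu> s)"
      using iff[of "mixture_median l \<mu> s"] assms by simp
    ultimately show False
      using neg assms by (simp add: mixture_cdf_def)
  qed
  ultimately show ?thesis by simp
qed

text \<open>The distribution function is compared with 1/2 at \<open>\<mu> + d * s\<close> and
  \<open>\<mu> - d * s\<close>. Since the atom 0 may lie anywhere relative to \<open>\<mu>\<close>,
  the first comparison discards its mass and the second counts it in full.\<close>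

lemma mixture_median_near_slab_mean:
  assumes "0 \<le> l" "l \<le> 1" "0 < s" "0 < d"
    and up: "1 / 2 \<le> (1 - l) * Phi d" and lo: "l + Phi (- d) < 1 / 2"
  shows "\<bar>(mixture_median l \<mu> s - \<mu>) / s\<bar> \<le> d"
proof -
  note iff = mixture_median_le_iff[OF assms(1-3), of \<mu>]
  have "1 / 2 \<le> mixture_cdf l \<mu> s (\<mu> + d * s)"
    using up assms by (simp add: mixture_cdf_def add_increasing)
  then have 1: "mixture_median l \<mu> s \<le> \<mu> + d * s"
    using iff by simp
  have "(1 - l) * Phi (- d) \<le> 1 * Phi (- d)"
    using assms Phi_nonneg by (intro mult_right_mono) auto
  moreover have "l * indicator {0..} (\<mu> - d * s) \<le> l"
    using assms by (simp split: split_indicator)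
  ultimately have "mixture_cdf l \<mu> s (\<mu> - d * s) < 1 / 2"
    using lo assms by (simp add: mixture_cdf_def)
  then have 2: "\<mu> - d * s \<le> mixture_median l \<mu> s"
    using iff[of "\<mu> - d * s"] by simp
  from 1 2 show ?thesis
    using assms by (simp add: abs_le_iff pos_divide_le_eq pos_le_divide_eq minus_divide_left)
qed

text \<open>As the spike weight vanishes, the two conditions of the preceding lemma tend to
  \<open>1/2 < Phi d\<close> and \<open>Phi (- d) < 1/2\<close>. They do not mention
  \<open>\<mu>\<close> or \<open>s\<close>, so both may vary freely with \<open>n\<close>.\<close>

lemma tendsto_mixture_median:
  assumes l: "l \<longlonglongrightarrow> 0" "eventually (\<lambda>n. 0 \<le> l n \<and> l n \<le> 1) sequentially" and s: "\<And>n. 0 < s n"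
  shows "(\<lambda>n. (mixture_median (l n) (\<mu> n) (s n) - \<mu> n) / s n) \<longlonglongrightarrow> 0"
proof (rule LIMSEQ_I)
  fix r :: real assume "0 < r"
  \<comment> \<open>Half of \<open>r\<close> turns the bound \<open>\<le> d\<close> into the strict
    bound below \<open>r\<close>.\<close>
  define d where "d = r / 2"
  have d: "0 < d" "d < r" using \<open>0 < r\<close> by (simp_all add: d_def)
  have "(\<lambda>n. (1 - l n) * Phi d) \<longlonglongrightarrow> (1 - 0) * Phi d"
    by (intro tendsto_intros l(1))
  then have 1: "eventually (\<lambda>n. 1 / 2 < (1 - l n) * Phi d) sequentially"
    using Phi_pos[OF d(1)] by (intro order_tendstoD(1)) auto
  have "(\<lambda>n. l n + Phi (- d)) \<longlonglongrightarrow> 0 + Phi (- d)"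
    by (intro tendsto_intros l(1))
  then have 2: "eventually (\<lambda>n. l n + Phi (- d) < 1 / 2) sequentially"
    using Phi_neg[OF d(1)] by (intro order_tendstoD(2)) auto
  have "eventually (\<lambda>n. norm ((mixture_median (l n) (\<mu> n) (s n) - \<mu> n) / s n - 0) < r) sequentially"
    using 1 2 l(2)
  proof eventually_elim
    case (elim n)
    then have "\<bar>(mixture_median (l n) (\<mu> n) (s n) - \<mu> n) / s n\<bar> \<le> d"
      by (intro mixture_median_near_slab_mean s d) auto
    with d show ?case by simp
  qed
  then show "\<exists>N. \<forall>n\<ge>N. norm ((mixture_median (l n) (\<mu> n) (s n) - \<mu> n) / s n - 0) < r"
    by (simp add: eventually_sequentially)
qed

context
  fixes v :: "nat \<Rightarrow> real" and \<sigma> \<pi>0 :: real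
  assumes v: "\<And>n. 0 < v n" and \<sigma>: "0 < \<sigma>" and \<pi>0: "0 < \<pi>0" "\<pi>0 < 1"
    and v_big: "filterlim (\<lambda>n. sqrt n * v n) at_top sequentially"
begin

lemma filterlim_n_v: "filterlim (\<lambda>n. real n * v n) at_top sequentially"
proof (rule filterlim_at_top_mono[OF v_big])
  show "eventually (\<lambda>n. sqrt n * v n \<le> real n * v n) sequentially"
    using eventually_ge_at_top[of 1]
  proof eventually_elim
    case (elim n)
    have "sqrt n * 1 \<le> sqrt n * sqrt n"
      using elim by (intro mult_left_mono) auto
    then show ?case
      using v[of n] by (intro mult_right_mono) (auto intro: less_imp_le)
  qed
qed

text \<open>For a zero block \<open>n * (z n j)\<^sup>2 = (u j)\<^sup>2\<close>, so the spike
  likelihood is a positive constant \<open>E\<close>, while each slab factor is at most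
  \<open>1 / sqrt (1 + n * v n)\<close> and vanishes.\<close>

lemma spike_weight_tendsto_1:
  assumes m: "0 < m" and z: "\<And>n j. 0 < n \<Longrightarrow> j < m \<Longrightarrow> z n j = u j / sqrt n"
  shows "(\<lambda>n. spike_weight \<pi>0 m n \<sigma> (v n) (z n)) \<longlonglongrightarrow> 1"
proof -
  define E where "E = (\<Prod>j<m. exp (- (u j)\<^sup>2 / (2 * \<sigma>\<^sup>2)))"
  have E: "0 < E" by (simp add: E_def prod_pos)
  have "filterlim (\<lambda>n. sqrt (1 + real n * v n)) at_top sequentially"
    by (intro filterlim_compose[OF sqrt_at_top] filterlim_tendsto_add_at_top[OF tendsto_const filterlim_n_v])
  then have sq: "(\<lambda>n. 1 / sqrt (1 + real n * v n)) \<longlonglongrightarrow> 0"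
    by (simp add: tendsto_divide_0[OF tendsto_const filterlim_at_top_imp_at_infinity])
  have slab: "(\<lambda>n. slab_factor n \<sigma> (v n) (z n j)) \<longlonglongrightarrow> 0" for j
  proof (rule tendsto_sandwich[OF _ _ tendsto_const sq]; intro always_eventually allI)
    fix n
    have "0 < 1 + n * v n" using v[of n] by (simp add: add_pos_nonneg)
    then show "0 \<le> slab_factor n \<sigma> (v n) (z n j)" "slab_factor n \<sigma> (v n) (z n j) \<le> 1 / sqrt (1 + n * v n)"
      by (auto simp: slab_factor_def intro!: divide_right_mono)
  qed
  have "(\<lambda>n. \<Prod>j<m. slab_factor n \<sigma> (v n) (z n j)) \<longlonglongrightarrow> (\<Prod>j<m. 0)"
    by (intro tendsto_prod slab)
  \<comment> \<open>The product of zeros is 0 because the block is nonempty; an empty product would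
    be 1.\<close>
  then have "(\<lambda>n. \<Prod>j<m. slab_factor n \<sigma> (v n) (z n j)) \<longlonglongrightarrow> 0"
    using m by (simp add: zero_power)
  then have "(\<lambda>n. \<pi>0 * E / (\<pi>0 * E + (1 - \<pi>0) * (\<Prod>j<m. slab_factor n \<sigma> (v n) (z n j)))) \<longlonglongrightarrow> \<pi>0 * E / (\<pi>0 * E + (1 - \<pi>0) * 0)"
    using E \<pi>0 m by (intro tendsto_intros) auto
  moreover have "eventually (\<lambda>n. \<pi>0 * E / (\<pi>0 * E + (1 - \<pi>0) * (\<Prod>j<m. slab_factor n \<sigma> (v n) (z n j)))
      = spike_weight \<pi>0 m n \<sigma> (v n) (z n)) sequentially"
    using eventually_gt_at_top[of 0]
  proof eventually_elim
    case (elim n)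
    then have "real n * (z n j)\<^sup>2 = (u j)\<^sup>2" if "j < m" for j
      using that by (simp add: z power_divide)
    then have "(\<Prod>j<m. exp (- n * (z n j)\<^sup>2 / (2 * \<sigma>\<^sup>2))) = E"
      by (simp add: E_def)
    then show ?case
      by (simp add: spike_weight_def block_evidence_def)
  qed
  ultimately show ?thesis
    using E \<pi>0 by (simp add: tendsto_cong)
qed

text \<open>The likelihood ratio of spike to slab is exp (n * sum of \<open>a n j\<close>). Its
  exponent per observation tends to \<open>b\<close>, minus the sum of
  \<open>(\<beta> j)\<^sup>2 / (2 * \<sigma>\<^sup>2)\<close>, which is negative because of
  coordinate \<open>k\<close>. The assumption on \<open>ln (v n) / n\<close> removes the
  contribution of the factors \<open>sqrt (1 + n * v n)\<close>.\<close>

lemma spike_weight_tendsto_0: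
  assumes v_log: "(\<lambda>n. ln (v n) / n) \<longlonglongrightarrow> 0"
    and z: "\<And>j. j < m \<Longrightarrow> (\<lambda>n. z n j) \<longlonglongrightarrow> \<beta> j" and k: "k < m" "\<beta> k \<noteq> 0"
  shows "(\<lambda>n. spike_weight \<pi>0 m n \<sigma> (v n) (z n)) \<longlonglongrightarrow> 0"
proof -
  have ln0: "(\<lambda>n. ln (1 + real n * v n) / n) \<longlonglongrightarrow> 0"
  proof (rule tendsto_sandwich[OF _ _ tendsto_const])
    show "eventually (\<lambda>n. 0 \<le> ln (1 + real n * v n) / n) sequentially"
      using less_imp_le[OF v] by (intro always_eventually allI divide_nonneg_nonneg ln_ge_zero) auto
    \<comment> \<open>Eventually \<open>1 \<le> n * v n\<close>, so \<open>1 + n * v n\<close> is at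
      most twice \<open>n * v n\<close> and its logarithm splits.\<close>
    show "eventually (\<lambda>n. ln (1 + real n * v n) / n \<le> ln 2 / n + ln n / n + ln (v n) / n) sequentially"
      using eventually_gt_at_top[of 0] filterlim_n_v[unfolded filterlim_at_top, rule_format, of 1]
    proof eventually_elim
      case (elim n)
      have "ln (1 + real n * v n) \<le> ln (2 * (real n * v n))"
        using elim v[of n] by (subst ln_le_cancel_iff) (auto simp: add_pos_pos)
      also have "\<dots> = ln 2 + ln n + ln (v n)"
        using elim v[of n] by (simp add: ln_mult)
      finally show ?case
        by (simp add: add_divide_distrib[symmetric] divide_right_mono)
    qed
    have "(\<lambda>n. ln 2 / real n + ln (real n) / real n + ln (v n) / real n) \<longlonglongrightarrow> 0 + 0 + 0"
      by (intro tendsto_add v_log) real_asymp+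
    then show "(\<lambda>n. ln 2 / real n + ln (real n) / real n + ln (v n) / real n) \<longlonglongrightarrow> 0" by simp
  qed
  have inv0: "(\<lambda>n. 1 / (1 + real n * v n)) \<longlonglongrightarrow> 0"
    by (intro tendsto_divide_0[OF tendsto_const] filterlim_at_top_imp_at_infinity
        filterlim_tendsto_add_at_top[OF tendsto_const filterlim_n_v])
  \<comment> \<open>The logarithm of the spike-to-slab likelihood ratio of coordinate
    \<open>j\<close>, divided by \<open>n\<close>.\<close>
  define a where "a n j = ln (1 + n * v n) / n / 2 - (z n j)\<^sup>2 / (2 * \<sigma>\<^sup>2) * (1 - 1 / (1 + n * v n))" for n :: nat and j
  define b where "b = - (\<Sum>j<m. (\<beta> j)\<^sup>2 / (2 * \<sigma>\<^sup>2))"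
  have "(\<lambda>n. a n j) \<longlonglongrightarrow> 0 / 2 - (\<beta> j)\<^sup>2 / (2 * \<sigma>\<^sup>2) * (1 - 0)" if "j < m" for j
    unfolding a_def using that \<sigma> by (intro tendsto_intros ln0 z inv0) auto
  then have "(\<lambda>n. \<Sum>j<m. a n j) \<longlonglongrightarrow> (\<Sum>j<m. 0 / 2 - (\<beta> j)\<^sup>2 / (2 * \<sigma>\<^sup>2) * (1 - 0))"
    by (intro tendsto_sum) auto
  then have a: "(\<lambda>n. \<Sum>j<m. a n j) \<longlonglongrightarrow> b"
    by (simp add: b_def sum_negf)
  have "0 < (\<Sum>j<m. (\<beta> j)\<^sup>2 / (2 * \<sigma>\<^sup>2))"
    using k \<sigma> by (intro sum_pos2[of _ k]) auto
  then have "b < 0" by (simp add: b_def)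
  have "filterlim (\<lambda>n. (\<Sum>j<m. a n j) * real n) at_bot sequentially"
    using filterlim_tendsto_neg_mult_at_bot[OF a \<open>b < 0\<close> filterlim_real_sequentially] .
  then have "(\<lambda>n. exp ((\<Sum>j<m. a n j) * real n)) \<longlonglongrightarrow> 0"
    by (rule filterlim_compose[OF exp_at_bot])
  then have lim: "(\<lambda>n. \<pi>0 / (1 - \<pi>0) * exp ((\<Sum>j<m. a n j) * real n)) \<longlonglongrightarrow> 0"
    by (rule tendsto_mult_right_zero)
  show ?thesis
  proof (rule tendsto_sandwich[OF _ _ tendsto_const lim])
    show "eventually (\<lambda>n. 0 \<le> spike_weight \<pi>0 m n \<sigma> (v n) (z n)) sequentially"
      using eventually_gt_at_top[of 0]
      by eventually_elim (use \<pi>0 \<sigma> v in \<open>auto intro!: spike_weight_nonneg\<close>)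
    show "eventually (\<lambda>n. spike_weight \<pi>0 m n \<sigma> (v n) (z n) \<le> \<pi>0 / (1 - \<pi>0) * exp ((\<Sum>j<m. a n j) * real n)) sequentially"
      using eventually_gt_at_top[of 0]
    proof eventually_elim
      case (elim n)
      define q where "q = 1 + n * v n"
      have q: "0 < q" using v[of n] by (simp add: q_def add_pos_nonneg)
      define E where "E = (\<Prod>j<m. exp (- real n * (z n j)\<^sup>2 / (2 * \<sigma>\<^sup>2)))"
      define D where "D = (\<Prod>j<m. slab_factor n \<sigma> (v n) (z n j))"
      have D: "0 < D"
        unfolding D_def using elim \<pi>0 \<sigma> v by (intro prod_pos) (auto intro!: slab_factor_pos)
      have E: "0 < E" by (simp add: E_def prod_pos)
      have "exp (a n j * n) * slab_factor n \<sigma> (v n) (z n j) = exp (- real n * (z n j)\<^sup>2 / (2 * \<sigma>\<^sup>2))" for j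
      proof -
        have "sqrt q = exp (ln q / 2)"
          using q by (simp add: ln_sqrt[symmetric])
        moreover have "a n j * n = ln q / 2 + (- real n * (z n j)\<^sup>2 / (2 * \<sigma>\<^sup>2) - - real n * (z n j)\<^sup>2 / (2 * \<sigma>\<^sup>2 * q))"
          using elim \<sigma> q by (simp add: a_def q_def[symmetric] field_simps)
        ultimately show ?thesis
          unfolding slab_factor_def q_def[symmetric] by (simp only: exp_add exp_diff) simp
      qed
      then have "E = (\<Prod>j<m. exp (a n j * n)) * D"
        by (simp only: E_def D_def prod.distrib[symmetric])
      then have ED: "E = exp ((\<Sum>j<m. a n j) * real n) * D"
        by (simp add: exp_sum sum_distrib_right)
      have "spike_weight \<pi>0 m n \<sigma> (v n) (z n) = \<pi>0 * E / (\<pi>0 * E + (1 - \<pi>0) * D)"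
        by (simp add: spike_weight_def block_evidence_def E_def D_def)
      \<comment> \<open>Dropping the spike from the denominator bounds the posterior probability by
        the posterior odds.\<close>
      also have "\<dots> \<le> \<pi>0 * E / ((1 - \<pi>0) * D)"
        using \<pi>0 E D by (intro divide_left_mono mult_pos_pos add_pos_pos mult_nonneg_nonneg) auto
      also have "\<dots> = \<pi>0 / (1 - \<pi>0) * exp ((\<Sum>j<m. a n j) * real n)"
        unfolding ED using D \<pi>0 by simp
      finally show ?case .
    qed
  qed
qed

text \<open>The slab mean minus \<open>z n\<close> is \<open>- z n / (1 + n * v n)\<close>; times
  \<open>sqrt n\<close> this is at most \<open>\<bar>z n\<bar> / (sqrt n * v n)\<close>. Here the
  growth of \<open>sqrt n * v n\<close> enters at full strength; the weight limits use only that
  \<open>n * v n\<close> diverges.\<close>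

lemma sqrt_n_shrinkage_tendsto_0:
  assumes "z \<longlonglongrightarrow> \<beta>"
  shows "(\<lambda>n. sqrt n * (n * v n * z n / (1 + n * v n) - z n)) \<longlonglongrightarrow> 0"
proof (rule Lim_null_comparison)
  have "(\<lambda>n. \<bar>z n\<bar> * (1 / (sqrt n * v n))) \<longlonglongrightarrow> \<bar>\<beta>\<bar> * 0"
    by (intro tendsto_intros assms tendsto_divide_0[OF tendsto_const] filterlim_at_top_imp_at_infinity v_big)
  then show "(\<lambda>n. \<bar>z n\<bar> * (1 / (sqrt n * v n))) \<longlonglongrightarrow> 0" by simp
  show "eventually (\<lambda>n. norm (sqrt n * (n * v n * z n / (1 + n * v n) - z n)) \<le> \<bar>z n\<bar> * (1 / (sqrt n * v n))) sequentially"
    using eventually_gt_at_top[of 0]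
  proof eventually_elim
    case (elim n)
    have q: "0 < 1 + n * v n" using v[of n] by (simp add: add_pos_nonneg)
    have "n * v n * z n / (1 + n * v n) - z n = - z n / (1 + n * v n)"
      using q by (simp add: field_simps)
    then have "norm (sqrt n * (n * v n * z n / (1 + n * v n) - z n)) = \<bar>z n\<bar> * (sqrt n / (1 + n * v n))"
      using q by (simp add: abs_mult)
    also have "sqrt n / (1 + n * v n) \<le> 1 / (sqrt n * v n)"
    proof -
      have "1 / (sqrt n * v n) = sqrt n / (sqrt n * sqrt n * v n)"
        using elim by (simp only: mult.assoc) simp
      also have "\<dots> = sqrt n / (n * v n)" by simp
      finally show ?thesis
        using elim v[of n] q by (auto intro!: divide_left_mono)
    qed
    finally show ?case by (simp add: mult_left_mono)
  qed
qed

text \<open>The scaled error has three parts: median minus slab mean, slab mean minus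
  \<open>z\<close>, and \<open>z\<close> minus \<open>\<beta>\<close>. The first is
  \<open>sqrt n * s n\<close>, bounded by \<open>\<sigma>\<close>, times a null sequence; the second
  is the shrinkage bias; the third is exactly \<open>u\<close>.\<close>

lemma sqrt_n_mixture_median_tendsto:
  assumes l: "l \<longlonglongrightarrow> 0" "eventually (\<lambda>n. 0 \<le> l n \<and> l n \<le> 1) sequentially"
    and z: "\<And>n. 0 < n \<Longrightarrow> z n = \<beta> + u / sqrt n"
  shows "(\<lambda>n. sqrt n * (mixture_median (l n) (n * v n * z n / (1 + n * v n)) (\<sigma> * sqrt (v n / (1 + n * v n))) - \<beta>)) \<longlonglongrightarrow> u"
proof -
  define \<mu> where "\<mu> n = n * v n * z n / (1 + n * v n)" for n :: nat
  define s where "s n = \<sigma> * sqrt (v n / (1 + n * v n))" for n :: nat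
  have q: "0 < 1 + real n * v n" for n using v[of n] by (simp add: add_pos_nonneg)
  have s: "0 < s n" for n using \<sigma> v q by (simp add: s_def)
  have "(\<lambda>n. \<beta> + u / sqrt n) \<longlonglongrightarrow> \<beta> + 0"
    by (intro tendsto_add tendsto_const) real_asymp
  moreover have "eventually (\<lambda>n. \<beta> + u / sqrt n = z n) sequentially"
    using eventually_gt_at_top[of 0] by eventually_elim (simp add: z)
  ultimately have "z \<longlonglongrightarrow> \<beta>"
    using Lim_transform_eventually by force
  have med: "(\<lambda>n. (mixture_median (l n) (\<mu> n) (s n) - \<mu> n) / s n) \<longlonglongrightarrow> 0"
    by (intro tendsto_mixture_median l s)
  have "(\<lambda>n. sqrt n * s n * ((mixture_median (l n) (\<mu> n) (s n) - \<mu> n) / s n)) \<longlonglongrightarrow> 0"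
  proof (rule Lim_null_comparison)
    show "(\<lambda>n. \<sigma> * \<bar>(mixture_median (l n) (\<mu> n) (s n) - \<mu> n) / s n\<bar>) \<longlonglongrightarrow> 0"
      using tendsto_mult_right_zero[OF tendsto_rabs_zero[OF med], of \<sigma>] by simp
    show "eventually (\<lambda>n. norm (sqrt n * s n * ((mixture_median (l n) (\<mu> n) (s n) - \<mu> n) / s n))
        \<le> \<sigma> * \<bar>(mixture_median (l n) (\<mu> n) (s n) - \<mu> n) / s n\<bar>) sequentially"
    proof (intro always_eventually allI)
      fix n
      have "sqrt n * s n = \<sigma> * sqrt (n * v n / (1 + n * v n))"
        by (simp add: s_def real_sqrt_mult real_sqrt_divide)
      also have "\<dots> \<le> \<sigma> * 1"
        using \<sigma> q[of n] by (intro mult_left_mono) (auto simp: divide_le_eq_1)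
      finally have "\<bar>sqrt n * s n\<bar> \<le> \<sigma>"
        using s[of n] by (simp add: abs_mult)
      then show "norm (sqrt n * s n * ((mixture_median (l n) (\<mu> n) (s n) - \<mu> n) / s n))
        \<le> \<sigma> * \<bar>(mixture_median (l n) (\<mu> n) (s n) - \<mu> n) / s n\<bar>"
        unfolding real_norm_def abs_mult[of "sqrt n * s n"] by (intro mult_right_mono) auto
    qed
  qed
  moreover have "(\<lambda>n. sqrt n * (\<mu> n - z n)) \<longlonglongrightarrow> 0"
    unfolding \<mu>_def by (rule sqrt_n_shrinkage_tendsto_0) fact
  ultimately have "(\<lambda>n. sqrt n * s n * ((mixture_median (l n) (\<mu> n) (s n) - \<mu> n) / s n) + sqrt n * (\<mu> n - z n) + u) \<longlonglongrightarrow> 0 + 0 + u"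
    by (intro tendsto_add tendsto_const)
  moreover have "eventually (\<lambda>n. sqrt n * s n * ((mixture_median (l n) (\<mu> n) (s n) - \<mu> n) / s n) + sqrt n * (\<mu> n - z n) + u
      = sqrt n * (mixture_median (l n) (\<mu> n) (s n) - \<beta>)) sequentially"
    using eventually_gt_at_top[of 0]
  proof eventually_elim
    case (elim n)
    have "sqrt n * s n * ((mixture_median (l n) (\<mu> n) (s n) - \<mu> n) / s n) = sqrt n * (mixture_median (l n) (\<mu> n) (s n) - \<mu> n)"
      using s[of n] by simp
    with elim show ?case by (simp add: z algebra_simps)
  qed
  ultimately show ?thesis
    unfolding \<mu>_def[symmetric] s_def[symmetric] by (simp add: tendsto_cong)
qed

end

section \<open>Continuity, measurability and the explicit median map\<close>

lemma tendsto_fun_coordinatewise: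
  fixes f :: "'b \<Rightarrow> 'i \<Rightarrow> 'a :: topological_space"
  assumes "\<And>i. ((\<lambda>x. f x i) \<longlongrightarrow> l i) F"
  shows "(f \<longlongrightarrow> l) F"
proof -
  have "limitin (product_topology (\<lambda>_. euclidean) UNIV) f l F"
    using assms by (simp add: limitin_componentwise)
  then show ?thesis by (simp add: euclidean_product_topology)
qed

text \<open>Continuity is given only on extensional functions, so \<open>f\<close> is composed with
  \<open>restrict\<close> to become continuous everywhere and hence Borel. Over a countable index
  type the Borel sets of the function space are tested coordinatewise, and coordinates outside
  \<open>A\<close> are constantly \<open>undefined\<close>.\<close>

lemma borel_measurable_continuous_on_PiE:
  fixes f :: "('i :: countable \<Rightarrow> real) \<Rightarrow> real"
  assumes "continuous_on (PiE A (\<lambda>_. UNIV)) f"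
  shows "f \<in> borel_measurable (PiM A (\<lambda>_. borel))"
proof -
  have "continuous_on UNIV (\<lambda>x :: 'i \<Rightarrow> real. restrict x A)"
  proof (rule continuous_on_coordinatewise_then_product)
    show "continuous_on UNIV (\<lambda>x :: 'i \<Rightarrow> real. restrict x A i)" for i
      by (cases "i \<in> A") simp_all
  qed
  then have "continuous_on UNIV (\<lambda>x. f (restrict x A))"
    by (rule continuous_on_compose2[OF assms]) auto
  then have [measurable]: "(\<lambda>x. f (restrict x A)) \<in> borel_measurable borel"
    by (rule borel_measurable_continuous_onI)
  have "(\<lambda>x. x) \<in> measurable (PiM A (\<lambda>_. borel :: real measure)) (borel :: ('i \<Rightarrow> real) measure)"
  proof (rule measurable_coordinatewise_then_product)
    fix i
    show "(\<lambda>x. x i) \<in> borel_measurable (PiM A (\<lambda>_. borel :: real measure))"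
    proof (cases "i \<in> A")
      case False
      then have "(\<lambda>x. x i) \<in> borel_measurable (PiM A (\<lambda>_. borel :: real measure)) \<longleftrightarrow>
        (\<lambda>x. undefined :: real) \<in> borel_measurable (PiM A (\<lambda>_. borel :: real measure))"
        by (intro measurable_cong) (auto simp: space_PiM PiE_def extensional_def)
      then show ?thesis by simp
    qed simp
  qed
  then have "(\<lambda>x. f (restrict x A)) \<in> borel_measurable (PiM A (\<lambda>_. borel))"
    by measurable
  moreover have "(\<lambda>x. f (restrict x A)) \<in> borel_measurable (PiM A (\<lambda>_. borel))
      \<longleftrightarrow> f \<in> borel_measurable (PiM A (\<lambda>_. borel))"
    by (intro measurable_cong) (simp add: space_PiM)
  ultimately show ?thesis by simp
qed

lemma spike_weight_cong:
  "(\<And>j. j < m \<Longrightarrow> z j = z' j) \<Longrightarrow> spike_weight \<pi>0 m N \<sigma> v z = spike_weight \<pi>0 m N \<sigma> v z'"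
  by (simp add: spike_weight_def block_evidence_def)

text \<open>The posterior median as an explicit function of the least squares estimate. It needs all
  of \<open>z\<close>, not just \<open>z j\<close>, because the spike weight is shared by the
  block.\<close>

definition median_of_estimate :: "real \<Rightarrow> nat \<Rightarrow> real \<Rightarrow> real \<Rightarrow> real \<Rightarrow> (nat \<Rightarrow> real) \<Rightarrow> nat \<Rightarrow> real" where
  "median_of_estimate \<pi>0 m N \<sigma> v z j =
     mixture_median (spike_weight \<pi>0 m N \<sigma> v z) (N * v * z j / (1 + N * v)) (\<sigma> * sqrt (v / (1 + N * v)))"

lemma median_of_estimate_cong:
  "(\<And>j. j < m \<Longrightarrow> z j = z' j) \<Longrightarrow> j < m \<Longrightarrow>
    median_of_estimate \<pi>0 m N \<sigma> v z j = median_of_estimate \<pi>0 m N \<sigma> v z' j"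
  unfolding median_of_estimate_def by (metis spike_weight_cong)

lemma median_of_estimate_le_iff:
  assumes "0 < \<pi>0" "\<pi>0 < 1" "0 < N" "0 < \<sigma>" "0 < v"
  shows "median_of_estimate \<pi>0 m N \<sigma> v z j \<le> c \<longleftrightarrow> 1 / 2 \<le> mixture_cdf (spike_weight \<pi>0 m N \<sigma> v z)
    (N * v * z j / (1 + N * v)) (\<sigma> * sqrt (v / (1 + N * v))) c"
  unfolding median_of_estimate_def using assms
  by (intro mixture_median_le_iff spike_weight_nonneg spike_weight_le_1) (auto simp: add_pos_pos)

text \<open>Both sides obey the same threshold criterion, and a real number is determined by the
  numbers that bound it above.\<close>

lemma post_median_eq_median_of_estimate:
  assumes \<sigma>: "0 < \<sigma>" and \<pi>0: "0 < \<pi>0" "\<pi>0 < 1" and n: "0 < n" and v: "\<forall>g<G. 0 < v g"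
    and orth: "\<forall>g<G. \<forall>j<m g. \<forall>g'<G. \<forall>j'<m g'.
      (\<Sum>i<n. X i g j * X i g' j') = (if g = g' \<and> j = j' then real n else 0)"
    and g: "g < G" and j: "j < m g"
  shows "post_median n X G m \<sigma> \<pi>0 (\<lambda>g. \<sigma> * sqrt (v g)) y g j
    = median_of_estimate \<pi>0 (m g) n \<sigma> (v g) (\<lambda>j. (\<Sum>i<n. X i g j * y i) / n) j" (is "?a = ?b")
proof -
  have "?a \<le> c \<longleftrightarrow> ?b \<le> c" for c
    by (subst post_median_le_iff[where z = "\<lambda>g j. (\<Sum>i<n. X i g j * y i) / n"])
      (use assms in \<open>simp_all add: median_of_estimate_le_iff\<close>)
  then show ?thesis by (meson order.antisym order.refl)
qed

text \<open>The infimum is measured through its sublevel sets, which the threshold criterion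
  describes by weight and distribution function, both measurable in \<open>z\<close>.\<close>

lemma borel_measurable_median_of_estimate:
  assumes "0 < \<pi>0" "\<pi>0 < 1" "0 < N" "0 < \<sigma>" "0 < v" and j: "j < m"
    and [measurable]: "\<And>k. k < m \<Longrightarrow> (\<lambda>x. z x k) \<in> borel_measurable M"
  shows "(\<lambda>x. median_of_estimate \<pi>0 m N \<sigma> v (z x) j) \<in> borel_measurable M"
proof (rule borel_measurableI_le)
  fix c
  note [measurable] = assms(7)[OF j]
  have [measurable]: "(\<lambda>x. \<Prod>k<m. exp (- N * (z x k)\<^sup>2 / (2 * \<sigma>\<^sup>2))) \<in> borel_measurable M"
    "(\<lambda>x. \<Prod>k<m. slab_factor N \<sigma> v (z x k)) \<in> borel_measurable M"
    unfolding slab_factor_def by (intro borel_measurable_prod; simp)+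
  have [measurable]: "(\<lambda>x. spike_weight \<pi>0 m N \<sigma> v (z x)) \<in> borel_measurable M"
    unfolding spike_weight_def block_evidence_def by measurable
  show "{x \<in> space M. median_of_estimate \<pi>0 m N \<sigma> v (z x) j \<le> c} \<in> sets M"
    unfolding median_of_estimate_le_iff[OF assms(1-5)] mixture_cdf_def by measurable
qed

section \<open>Limits of the posterior median at a fixed \<open>u\<close>\<close>

context
  fixes v :: "nat \<Rightarrow> real" and \<sigma> \<pi>0 :: real and m :: nat and \<beta> u :: "nat \<Rightarrow> real"
  assumes v: "\<And>n. 0 < v n" and \<sigma>: "0 < \<sigma>" and \<pi>0: "0 < \<pi>0" "\<pi>0 < 1"
    and v_big: "filterlim (\<lambda>n. sqrt n * v n) at_top sequentially"
begin

lemma eventually_median_of_estimate_eq_0: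
  assumes "\<And>j. j < m \<Longrightarrow> \<beta> j = 0" and j: "j < m"
  shows "eventually (\<lambda>n. median_of_estimate \<pi>0 m n \<sigma> (v n) (\<lambda>j. \<beta> j + u j / sqrt n) j = 0) sequentially"
proof -
  have "(\<lambda>n. spike_weight \<pi>0 m n \<sigma> (v n) (\<lambda>j. \<beta> j + u j / sqrt n)) \<longlonglongrightarrow> 1"
    by (rule spike_weight_tendsto_1[where u=u]) (use assms v \<sigma> \<pi>0 v_big in auto)
  then have "eventually (\<lambda>n. 1 / 2 < spike_weight \<pi>0 m n \<sigma> (v n) (\<lambda>j. \<beta> j + u j / sqrt n)) sequentially"
    by (rule order_tendstoD) simp
  then show ?thesis
    using eventually_gt_at_top[of 0]
  proof eventually_elim
    case (elim n)
    then show ?case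
      unfolding median_of_estimate_def using v[of n] \<sigma> \<pi>0
      by (intro mixture_median_eq_0 spike_weight_le_1) (auto simp: add_pos_pos)
  qed
qed

text \<open>The index \<open>j\<close> need not be \<open>k\<close>: a single nonzero coordinate
  drives the whole block to the slab, so zero coordinates of an active block get the same Gaussian
  limit.\<close>

lemma sqrt_n_median_of_estimate_tendsto:
  assumes v_log: "(\<lambda>n. ln (v n) / n) \<longlonglongrightarrow> 0" and k: "k < m" "\<beta> k \<noteq> 0"
  shows "(\<lambda>n. sqrt n * (median_of_estimate \<pi>0 m n \<sigma> (v n) (\<lambda>j. \<beta> j + u j / sqrt n) j - \<beta> j)) \<longlonglongrightarrow> u j"
  unfolding median_of_estimate_def
proof (rule sqrt_n_mixture_median_tendsto[OF v \<sigma> \<pi>0 v_big])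
  have "(\<lambda>n. \<beta> j + u j / sqrt n) \<longlonglongrightarrow> \<beta> j + 0" for j
    by (intro tendsto_add tendsto_const) real_asymp
  then show "(\<lambda>n. spike_weight \<pi>0 m n \<sigma> (v n) (\<lambda>j. \<beta> j + u j / sqrt n)) \<longlonglongrightarrow> 0"
    using k by (intro spike_weight_tendsto_0[OF v \<sigma> \<pi>0 v_big v_log, where \<beta>=\<beta>]) auto
  show "eventually (\<lambda>n. 0 \<le> spike_weight \<pi>0 m n \<sigma> (v n) (\<lambda>j. \<beta> j + u j / sqrt n) \<and>
      spike_weight \<pi>0 m n \<sigma> (v n) (\<lambda>j. \<beta> j + u j / sqrt n) \<le> 1) sequentially"
    using eventually_gt_at_top[of 0]
    by eventually_elim (use v \<sigma> \<pi>0 in \<open>simp add: spike_weight_nonneg spike_weight_le_1\<close>)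
qed simp

text \<open>Multiplying the scaled limit by \<open>1 / sqrt n\<close> gives consistency, and a
  sequence tending to \<open>\<beta> k \<noteq> 0\<close> is eventually nonzero.\<close>

lemma eventually_median_of_estimate_neq_0:
  assumes v_log: "(\<lambda>n. ln (v n) / n) \<longlonglongrightarrow> 0" and k: "k < m" "\<beta> k \<noteq> 0"
  shows "eventually (\<lambda>n. median_of_estimate \<pi>0 m n \<sigma> (v n) (\<lambda>j. \<beta> j + u j / sqrt n) k \<noteq> 0) sequentially"
proof -
  let ?Q = "\<lambda>n. median_of_estimate \<pi>0 m n \<sigma> (v n) (\<lambda>j. \<beta> j + u j / sqrt n) k"
  have "(\<lambda>n. sqrt n * (?Q n - \<beta> k) * (1 / sqrt n) + \<beta> k) \<longlonglongrightarrow> u k * 0 + \<beta> k"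
    by (intro tendsto_intros sqrt_n_median_of_estimate_tendsto[OF v_log k]) real_asymp
  then have "eventually (\<lambda>n. sqrt n * (?Q n - \<beta> k) * (1 / sqrt n) + \<beta> k \<noteq> 0) sequentially"
    using k by (intro tendsto_imp_eventually_ne) auto
  then show ?thesis
    using eventually_gt_at_top[of 0] by eventually_elim auto
qed

end

section \<open>Selection consistency and asymptotic normality\<close>

theorem theorem2:
  fixes G :: nat and m :: "nat \<Rightarrow> nat" and p :: nat
    and X :: "nat \<Rightarrow> nat \<Rightarrow> nat \<Rightarrow> nat \<Rightarrow> real"
    and \<beta>0 :: "nat \<Rightarrow> nat \<Rightarrow> real"
    and \<sigma> \<pi>0 :: real
    and tau2 :: "nat \<Rightarrow> nat \<Rightarrow> real"
    and noise :: "nat \<Rightarrow> (nat \<Rightarrow> real) measure"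
    and Y :: "nat \<Rightarrow> (nat \<Rightarrow> real) \<Rightarrow> nat \<Rightarrow> real"
    and bhat :: "nat \<Rightarrow> (nat \<Rightarrow> real) \<Rightarrow> nat \<Rightarrow> nat \<Rightarrow> real"
    and A :: "(nat \<times> nat) set"
  defines "p \<equiv> (\<Sum>g<G. m g)"
    and "noise \<equiv> (\<lambda>n. PiM {..<n} (\<lambda>_. gauss 0 \<sigma>))"
    and "Y \<equiv> (\<lambda>n \<epsilon> i. linpred (X n) G m \<beta>0 i + \<epsilon> i)"
    and "bhat \<equiv> (\<lambda>n \<epsilon> g j. post_median n (X n) G m \<sigma> \<pi>0 (\<lambda>g. \<sigma> * sqrt (tau2 g n)) (Y n \<epsilon>) g j)"
    and "A \<equiv> {(g, j). g < G \<and> j < m g \<and> (\<exists>j'<m g. \<beta>0 g j' \<noteq> 0)}"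
  assumes m_pos: "\<forall>g<G. 0 < m g"
    and sigma_pos: "0 < \<sigma>"
    and pi0: "0 < \<pi>0" "\<pi>0 < 1"
    and orth: "\<forall>n\<ge>p. \<forall>g<G. \<forall>j<m g. \<forall>g'<G. \<forall>j'<m g'.
                 (\<Sum>i<n. X n i g j * X n i g' j') = (if g = g' \<and> j = j' then real n else 0)"
    and tau_pos: "\<forall>g<G. \<forall>n. 0 < tau2 g n"
    and tau_big: "\<forall>g<G. filterlim (\<lambda>n. sqrt (real n) * tau2 g n) at_top sequentially"
    and tau_log: "\<forall>g<G. (\<lambda>n. ln (tau2 g n) / real n) \<longlonglongrightarrow> 0"
  shows "((\<lambda>n. measure (noise n)
            {\<epsilon> \<in> space (noise n). \<forall>g<G. (\<exists>j<m g. bhat n \<epsilon> g j \<noteq> 0) \<longleftrightarrow> (\<exists>j<m g. \<beta>0 g j \<noteq> 0)})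
          \<longlonglongrightarrow> 1)
       \<and> conv_distr A
           (\<lambda>n. distr (noise n) (PiM A (\<lambda>_. borel))
                  (\<lambda>\<epsilon>. \<lambda>k\<in>A. sqrt (real n) * (bhat n \<epsilon> (fst k) (snd k) - \<beta>0 (fst k) (snd k))))
           (PiM A (\<lambda>_. gauss 0 \<sigma>))"
proof
  define K where "K = Sigma {..<G} (\<lambda>g. {..<m g})"
  have finK: "finite K" by (simp add: K_def)
  have AK: "A \<subseteq> K" by (auto simp: A_def K_def)
  define \<gamma> where "\<gamma> = PiM K (\<lambda>_. gauss 0 \<sigma>)"
  interpret \<gamma>: prob_space \<gamma>
    unfolding \<gamma>_def by (intro prob_space_PiM prob_space_gauss sigma_pos)
  have sets_\<gamma>[measurable_cong]: "sets \<gamma> = sets (PiM K (\<lambda>_. borel))"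
    unfolding \<gamma>_def by (intro sets_PiM_cong) auto
  have sets_noise[measurable_cong]: "sets (noise n) = sets (PiM {..<n} (\<lambda>_. borel))" for n
    unfolding noise_def by (intro sets_PiM_cong) auto
  \<comment> \<open>The columns of the design have squared length n, so dividing by
    \<open>sqrt n\<close> makes them orthonormal. \<open>U\<close> is the overview's
    \<open>u\<close> as a function of the noise, and \<open>Q n u g j\<close> is the posterior
    median in terms of \<open>u\<close>.\<close>
  define U where "U n \<epsilon> = (\<lambda>k\<in>K. \<Sum>i<n. X n i (fst k) (snd k) / sqrt n * \<epsilon> i)"
    for n :: nat and \<epsilon> :: "nat \<Rightarrow> real"
  define Q where "Q n u g j = median_of_estimate \<pi>0 (m g) n \<sigma> (tau2 g n) (\<lambda>j. \<beta>0 g j + u (g, j) / sqrt n) j"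
    for n :: nat and u :: "nat \<times> nat \<Rightarrow> real" and g j
  have U_meas[measurable]: "U n \<in> measurable (noise n) (PiM K (\<lambda>_. borel))" for n
    unfolding U_def[abs_def] by measurable
  have U_distr: "distr (noise n) (PiM K (\<lambda>_. borel)) (U n) = \<gamma>" if n: "0 < n" "p \<le> n" for n
    unfolding noise_def U_def[abs_def] \<gamma>_def
  proof (rule gauss_orthonormal_image[OF sigma_pos _ finK])
    fix k l assume kl: "k \<in> K" "l \<in> K"
    have "(\<Sum>i<n. X n i (fst k) (snd k) / sqrt n * (X n i (fst l) (snd l) / sqrt n))
        = (\<Sum>i<n. X n i (fst k) (snd k) * X n i (fst l) (snd l)) / n"
      by (simp add: sum_divide_distrib)
    also have "\<dots> = (if k = l then 1 else 0)"
      using orth kl n by (auto simp: K_def prod_eq_iff)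
    finally show "(\<Sum>i<n. X n i (fst k) (snd k) / sqrt n * (X n i (fst l) (snd l) / sqrt n)) = (if k = l then 1 else 0)" .
  qed simp
  \<comment> \<open>This holds for every single noise vector, not merely in law: orthogonality makes
    the least squares estimate equal to \<open>\<beta>0 + U / sqrt n\<close>, so all randomness
    passes through \<open>U\<close>.\<close>
  have bhat_Q: "bhat n \<epsilon> g j = Q n (U n \<epsilon>) g j" if n: "0 < n" "p \<le> n" and gj: "g < G" "j < m g" for n \<epsilon> g j
  proof -
    have "(\<Sum>i<n. X n i g j * Y n \<epsilon> i) / n = \<beta>0 g j + U n \<epsilon> (g, j) / sqrt n" if j: "j < m g" for j
    proof -
      let ?t = "\<lambda>i g' j'. X n i g j * (X n i g' j' * \<beta>0 g' j')"
      have "(\<Sum>i<n. X n i g j * linpred (X n) G m \<beta>0 i) = (\<Sum>i<n. \<Sum>g'<G. \<Sum>j'<m g'. ?t i g' j')"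
        unfolding linpred_def sum_distrib_left ..
      also have "\<dots> = (\<Sum>g'<G. \<Sum>i<n. \<Sum>j'<m g'. ?t i g' j')"
        by (rule sum.swap)
      also have "\<dots> = (\<Sum>g'<G. \<Sum>j'<m g'. \<Sum>i<n. ?t i g' j')"
        by (intro sum.cong refl sum.swap)
      also have "\<dots> = (\<Sum>g'<G. \<Sum>j'<m g'. \<beta>0 g' j' * (\<Sum>i<n. X n i g j * X n i g' j'))"
        by (simp add: sum_distrib_left ac_simps)
      also have "\<dots> = (\<Sum>g'<G. \<Sum>j'<m g'. if g = g' then if j = j' then n * \<beta>0 g j else 0 else 0)"
        using orth n gj j by (intro sum.cong refl) auto
      also have "\<dots> = (\<Sum>g'<G. if g = g' then n * \<beta>0 g j else 0)"
        using j by (intro sum.cong refl) auto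
      also have "\<dots> = n * \<beta>0 g j"
        using gj by simp
      finally have "(\<Sum>i<n. X n i g j * linpred (X n) G m \<beta>0 i) = n * \<beta>0 g j" .
      moreover have "U n \<epsilon> (g, j) / sqrt n = (\<Sum>i<n. X n i g j * \<epsilon> i) / n"
        using gj j by (simp add: U_def K_def sum_divide_distrib)
      ultimately show ?thesis
        using n by (simp add: Y_def distrib_left sum.distrib add_divide_distrib)
    qed
    then show ?thesis
      unfolding bhat_def Q_def using n gj orth sigma_pos pi0 tau_pos
      by (subst post_median_eq_median_of_estimate) (auto intro!: median_of_estimate_cong)
  qed
  have Q_meas: "(\<lambda>u. Q n u g j) \<in> borel_measurable \<gamma>" if "0 < n" "g < G" "j < m g" for n g j
    unfolding Q_def
  proof (rule borel_measurable_median_of_estimate)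
    fix k assume "k < m g"
    then have "(g, k) \<in> K" using that by (simp add: K_def)
    then have [measurable]: "(\<lambda>u. u (g, k)) \<in> borel_measurable \<gamma>"
      by (simp add: measurable_cong_sets[OF sets_\<gamma> refl] measurable_component_singleton)
    show "(\<lambda>u. \<beta>0 g k + u (g, k) / sqrt n) \<in> borel_measurable \<gamma>"
      by measurable
  qed (use that pi0 sigma_pos tau_pos in auto)
  have large: "eventually (\<lambda>n. 0 < n \<and> p \<le> n) sequentially"
    using eventually_gt_at_top[of 0] eventually_ge_at_top[of p] by eventually_elim simp

  \<comment> \<open>The event of correct selection, transported to the fixed space
    \<open>\<gamma>\<close>.\<close>
  define good where "good n = {u \<in> space \<gamma>. \<forall>g<G. (\<exists>j<m g. Q n u g j \<noteq> 0) \<longleftrightarrow> (\<exists>j<m g. \<beta>0 g j \<noteq> 0)}" for n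
  have good_meas: "good n \<in> sets \<gamma>" if "0 < n" for n
  proof -
    have "{u \<in> space \<gamma>. Q n u g j \<noteq> 0} \<in> sets \<gamma>" if "g < G" "j < m g" for g j
      using Q_meas[OF \<open>0 < n\<close> that] by measurable
    then have "{u \<in> space \<gamma>. \<forall>g\<in>{..<G}. (\<exists>j\<in>{..<m g}. Q n u g j \<noteq> 0) \<longleftrightarrow> (\<exists>j<m g. \<beta>0 g j \<noteq> 0)} \<in> sets \<gamma>"
      by (intro sets.sets_Collect_finite_All sets.sets_Collect_finite_Ex sets.sets_Collect) auto
    moreover have "{u \<in> space \<gamma>. \<forall>g\<in>{..<G}. (\<exists>j\<in>{..<m g}. Q n u g j \<noteq> 0) \<longleftrightarrow> (\<exists>j<m g. \<beta>0 g j \<noteq> 0)} = good n"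
      by (auto simp: good_def Bex_def)
    ultimately show ?thesis by simp
  qed
  \<comment> \<open>Pointwise in \<open>u\<close>, with no uniformity: finitely many blocks and
    coordinates let the eventual statements be combined. An active block needs one nonzero
    coordinate, an inactive one needs all coordinates zero.\<close>
  have good_ev: "eventually (\<lambda>n. u \<in> good n) sequentially" if u: "u \<in> space \<gamma>" for u
  proof -
    have "eventually (\<lambda>n. (\<exists>j<m g. Q n u g j \<noteq> 0) \<longleftrightarrow> (\<exists>j<m g. \<beta>0 g j \<noteq> 0)) sequentially"
      if g: "g < G" for g
    proof (cases "\<exists>k<m g. \<beta>0 g k \<noteq> 0")
      case True
      then obtain k where k: "k < m g" "\<beta>0 g k \<noteq> 0" by blast
      have "eventually (\<lambda>n. Q n u g k \<noteq> 0) sequentially"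
        unfolding Q_def
        by (rule eventually_median_of_estimate_neq_0) (use k g tau_pos sigma_pos pi0 tau_big tau_log in auto)
      then show ?thesis
        by eventually_elim (use k in blast)
    next
      case False
      then have "\<forall>j\<in>{..<m g}. eventually (\<lambda>n. Q n u g j = 0) sequentially"
        unfolding Q_def
        by (intro ballI eventually_median_of_estimate_eq_0) (use g tau_pos sigma_pos pi0 tau_big in auto)
      then have "eventually (\<lambda>n. \<forall>j\<in>{..<m g}. Q n u g j = 0) sequentially"
        by (intro eventually_ball_finite) auto
      then show ?thesis
        by eventually_elim (use False in auto)
    qed
    then have "eventually (\<lambda>n. \<forall>g\<in>{..<G}. (\<exists>j<m g. Q n u g j \<noteq> 0) \<longleftrightarrow> (\<exists>j<m g. \<beta>0 g j \<noteq> 0)) sequentially"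
      by (intro eventually_ball_finite) auto
    then show ?thesis
      by eventually_elim (use u in \<open>simp add: good_def\<close>)
  qed
  \<comment> \<open>Orthogonality is available from \<open>p\<close> on, and division by
    \<open>sqrt n\<close> needs \<open>0 < n\<close>; the successor secures the latter even for
    \<open>p = 0\<close>. After the shift by \<open>N\<close> every term is usable, and the shift
    does not change the limit.\<close>
  define N where "N = Suc p"
  have N: "0 < n + N" "p \<le> n + N" for n by (simp_all add: N_def)
  have "(\<lambda>n. \<integral>u. indicator (good (n + N)) u \<partial>\<gamma>) \<longlonglongrightarrow> (\<integral>u. 1 \<partial>\<gamma> :: real)"
  proof (rule integral_dominated_convergence[where w="\<lambda>_. 1"])
    show "(\<lambda>u. indicator (good (n + N)) u :: real) \<in> borel_measurable \<gamma>" for n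
      using good_meas N by simp
    show "AE u in \<gamma>. (\<lambda>n. indicator (good (n + N)) u :: real) \<longlonglongrightarrow> 1"
    proof (rule AE_I2)
      fix u assume "u \<in> space \<gamma>"
      from good_ev[OF this] have "(\<lambda>n. indicator (good n) u :: real) \<longlonglongrightarrow> 1"
        by (intro tendsto_eventually) (auto elim!: eventually_mono)
      then show "(\<lambda>n. indicator (good (n + N)) u :: real) \<longlonglongrightarrow> 1"
        by (rule LIMSEQ_ignore_initial_segment)
    qed
  qed (auto split: split_indicator)
  moreover have "measure (noise (n + N)) {\<epsilon> \<in> space (noise (n + N)). \<forall>g<G. (\<exists>j<m g. bhat (n + N) \<epsilon> g j \<noteq> 0) \<longleftrightarrow> (\<exists>j<m g. \<beta>0 g j \<noteq> 0)}
      = (\<integral>u. indicator (good (n + N)) u \<partial>\<gamma>)" for n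
  proof -
    have iff: "(\<exists>j<m g. bhat (n + N) \<epsilon> g j \<noteq> 0) \<longleftrightarrow> (\<exists>j<m g. Q (n + N) (U (n + N) \<epsilon>) g j \<noteq> 0)" if "g < G" for g \<epsilon>
      using bhat_Q[OF N that] by metis
    have "U (n + N) \<epsilon> \<in> space \<gamma>" if "\<epsilon> \<in> space (noise (n + N))" for \<epsilon>
      using measurable_space[OF U_meas that] sets_eq_imp_space_eq[OF sets_\<gamma>] by simp
    then have "{\<epsilon> \<in> space (noise (n + N)). \<forall>g<G. (\<exists>j<m g. bhat (n + N) \<epsilon> g j \<noteq> 0) \<longleftrightarrow> (\<exists>j<m g. \<beta>0 g j \<noteq> 0)}
        = U (n + N) -` good (n + N) \<inter> space (noise (n + N))"
      by (simp add: good_def iff set_eq_iff cong: conj_cong) blast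
    also have "measure (noise (n + N)) \<dots> = measure (distr (noise (n + N)) (PiM K (\<lambda>_. borel)) (U (n + N))) (good (n + N))"
      using good_meas[OF N(1)] sets_\<gamma> by (subst measure_distr) auto
    also have "\<dots> = measure \<gamma> (good (n + N))"
      by (simp only: U_distr[OF N])
    finally show ?thesis
      using good_meas[OF N(1)] by simp
  qed
  ultimately have "(\<lambda>n. measure (noise (n + N)) {\<epsilon> \<in> space (noise (n + N)). \<forall>g<G. (\<exists>j<m g. bhat (n + N) \<epsilon> g j \<noteq> 0) \<longleftrightarrow> (\<exists>j<m g. \<beta>0 g j \<noteq> 0)}) \<longlonglongrightarrow> 1"
    by (simp add: \<gamma>.prob_space)
  then show "(\<lambda>n. measure (noise n) {\<epsilon> \<in> space (noise n). \<forall>g<G. (\<exists>j<m g. bhat n \<epsilon> g j \<noteq> 0) \<longleftrightarrow> (\<exists>j<m g. \<beta>0 g j \<noteq> 0)}) \<longlonglongrightarrow> 1"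
    by (rule LIMSEQ_offset)

  \<comment> \<open>The scaled error of the active coordinates as a map on the fixed space
    \<open>\<gamma>\<close>. It converges pointwise to the projection to \<open>A\<close>, so
    convergence in distribution needs only dominated convergence.\<close>
  define \<Psi> where "\<Psi> n u = (\<lambda>k\<in>A. sqrt n * (Q n u (fst k) (snd k) - \<beta>0 (fst k) (snd k)))" for n u
  have \<Psi>_meas: "\<Psi> n \<in> measurable \<gamma> (PiM A (\<lambda>_. borel))" if "0 < n" for n
    unfolding \<Psi>_def[abs_def]
  proof (rule measurable_restrict)
    fix k assume "k \<in> A"
    then have [measurable]: "(\<lambda>u. Q n u (fst k) (snd k)) \<in> borel_measurable \<gamma>"
      using that by (intro Q_meas) (auto simp: A_def)
    show "(\<lambda>u. sqrt n * (Q n u (fst k) (snd k) - \<beta>0 (fst k) (snd k))) \<in> borel_measurable \<gamma>"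
      by measurable
  qed
  have \<Psi>_lim: "(\<lambda>n. \<Psi> n u) \<longlonglongrightarrow> restrict u A" for u
  proof (rule tendsto_fun_coordinatewise)
    fix k
    show "(\<lambda>n. \<Psi> n u k) \<longlonglongrightarrow> restrict u A k"
    proof (cases "k \<in> A")
      case True
      then obtain g j k' where k: "k = (g, j)" "g < G" "j < m g" "k' < m g" "\<beta>0 g k' \<noteq> 0"
        by (auto simp: A_def)
      have "(\<lambda>n. sqrt n * (Q n u g j - \<beta>0 g j)) \<longlonglongrightarrow> u (g, j)"
        unfolding Q_def
        by (rule sqrt_n_median_of_estimate_tendsto[where u="\<lambda>j. u (g, j)"])
          (use k tau_pos sigma_pos pi0 tau_big tau_log in auto)
      then show ?thesis
        using True by (simp add: \<Psi>_def k(1))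
    qed (simp add: \<Psi>_def)
  qed
  show "conv_distr A
           (\<lambda>n. distr (noise n) (PiM A (\<lambda>_. borel))
                  (\<lambda>\<epsilon>. \<lambda>k\<in>A. sqrt (real n) * (bhat n \<epsilon> (fst k) (snd k) - \<beta>0 (fst k) (snd k))))
           (PiM A (\<lambda>_. gauss 0 \<sigma>))"
    unfolding conv_distr_def
  proof (intro allI impI, elim conjE exE)
    fix f :: "(nat \<times> nat \<Rightarrow> real) \<Rightarrow> real" and B
    assume f: "continuous_on (PiE A (\<lambda>_. UNIV)) f" and B: "\<forall>x\<in>PiE A (\<lambda>_. UNIV). \<bar>f x\<bar> \<le> B"
    have f_meas: "f \<in> borel_measurable (PiM A (\<lambda>_. borel))"
      by (rule borel_measurable_continuous_on_PiE[OF f])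
    have \<Psi>_PiE: "\<Psi> n u \<in> PiE A (\<lambda>_. UNIV)" for n u
      by (simp add: \<Psi>_def)
    have restr: "(\<lambda>u. restrict u A) \<in> measurable \<gamma> (PiM A (\<lambda>_. borel))"
      using AK unfolding measurable_cong_sets[OF sets_\<gamma> refl]
      by (intro measurable_restrict measurable_component_singleton) auto
    have "(\<lambda>n. \<integral>u. f (\<Psi> (n + N) u) \<partial>\<gamma>) \<longlonglongrightarrow> (\<integral>u. f (restrict u A) \<partial>\<gamma>)"
    proof (rule integral_dominated_convergence[where w="\<lambda>_. B"])
      show "(\<lambda>u. f (restrict u A)) \<in> borel_measurable \<gamma>"
        using restr f_meas by measurable
      show "(\<lambda>u. f (\<Psi> (n + N) u)) \<in> borel_measurable \<gamma>" for n
        using \<Psi>_meas[OF N(1)] f_meas by measurable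
      show "AE u in \<gamma>. norm (f (\<Psi> (n + N) u)) \<le> B" for n
        using B \<Psi>_PiE by simp
      \<comment> \<open>Continuity of \<open>f\<close> on the extensional functions suffices, since
        both \<open>\<Psi> n u\<close> and the limit lie there.\<close>
      have "(\<lambda>n. f (\<Psi> n u)) \<longlonglongrightarrow> f (restrict u A)" for u
        by (rule continuous_on_tendsto_compose[OF f \<Psi>_lim]) (auto simp: \<Psi>_PiE)
      then show "AE u in \<gamma>. (\<lambda>n. f (\<Psi> (n + N) u)) \<longlonglongrightarrow> f (restrict u A)"
        by (intro AE_I2 LIMSEQ_ignore_initial_segment)
    qed simp
    \<comment> \<open>Projecting the product Gaussian on \<open>K\<close> to the coordinates in
      \<open>A\<close> gives the product Gaussian on \<open>A\<close>.\<close>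
    moreover have "(\<integral>u. f (restrict u A) \<partial>\<gamma>) = (\<integral>x. f x \<partial>PiM A (\<lambda>_. gauss 0 \<sigma>))"
    proof -
      interpret product_prob_space "\<lambda>_. gauss 0 \<sigma>" K
        using prob_space_gauss[OF sigma_pos]
        by (simp add: product_prob_space_def product_prob_space_axioms_def product_sigma_finite_def prob_space_imp_sigma_finite)
      have sets: "sets (PiM A (\<lambda>_. gauss 0 \<sigma>)) = sets (PiM A (\<lambda>_. borel))"
        by (intro sets_PiM_cong) auto
      have "(\<integral>x. f x \<partial>PiM A (\<lambda>_. gauss 0 \<sigma>)) = (\<integral>x. f x \<partial>distr \<gamma> (PiM A (\<lambda>_. gauss 0 \<sigma>)) (\<lambda>u. restrict u A))"
        unfolding \<gamma>_def using distr_restrict[OF AK finK] by simp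
      also have "\<dots> = (\<integral>u. f (restrict u A) \<partial>\<gamma>)"
        using restr f_meas sets by (intro integral_distr) (simp_all cong: measurable_cong_sets)
      finally show ?thesis by simp
    qed
    moreover have "(\<integral>x. f x \<partial>distr (noise (n + N)) (PiM A (\<lambda>_. borel))
                  (\<lambda>\<epsilon>. \<lambda>k\<in>A. sqrt (real (n + N)) * (bhat (n + N) \<epsilon> (fst k) (snd k) - \<beta>0 (fst k) (snd k))))
        = (\<integral>u. f (\<Psi> (n + N) u) \<partial>\<gamma>)" for n
    proof -
      have eq: "(\<lambda>\<epsilon>. \<lambda>k\<in>A. sqrt (real (n + N)) * (bhat (n + N) \<epsilon> (fst k) (snd k) - \<beta>0 (fst k) (snd k)))
          = (\<lambda>\<epsilon>. \<Psi> (n + N) (U (n + N) \<epsilon>))"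
        unfolding \<Psi>_def by (intro ext restrict_ext) (auto simp: A_def bhat_Q[OF N])
      have \<Psi>': "\<Psi> (n + N) \<in> measurable (PiM K (\<lambda>_. borel)) (PiM A (\<lambda>_. borel))"
        using \<Psi>_meas[OF N(1)] unfolding measurable_cong_sets[OF sets_\<gamma> refl] .
      have "(\<integral>x. f x \<partial>distr (noise (n + N)) (PiM A (\<lambda>_. borel)) (\<lambda>\<epsilon>. \<Psi> (n + N) (U (n + N) \<epsilon>)))
          = (\<integral>\<epsilon>. f (\<Psi> (n + N) (U (n + N) \<epsilon>)) \<partial>noise (n + N))"
        by (intro integral_distr measurable_compose[OF U_meas \<Psi>'] f_meas)
      also have "\<dots> = (\<integral>u. f (\<Psi> (n + N) u) \<partial>distr (noise (n + N)) (PiM K (\<lambda>_. borel)) (U (n + N)))"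
        by (rule integral_distr[symmetric, OF U_meas measurable_compose[OF \<Psi>' f_meas]])
      finally show ?thesis
        unfolding eq U_distr[OF N] .
    qed
    ultimately have "(\<lambda>n. \<integral>x. f x \<partial>distr (noise (n + N)) (PiM A (\<lambda>_. borel))
                  (\<lambda>\<epsilon>. \<lambda>k\<in>A. sqrt (real (n + N)) * (bhat (n + N) \<epsilon> (fst k) (snd k) - \<beta>0 (fst k) (snd k))))
       \<longlonglongrightarrow> (\<integral>x. f x \<partial>PiM A (\<lambda>_. gauss 0 \<sigma>))"
      by simp
    then show "(\<lambda>n. \<integral>x. f x \<partial>distr (noise n) (PiM A (\<lambda>_. borel))
                  (\<lambda>\<epsilon>. \<lambda>k\<in>A. sqrt (real n) * (bhat n \<epsilon> (fst k) (snd k) - \<beta>0 (fst k) (snd k))))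
       \<longlonglongrightarrow> (\<integral>x. f x \<partial>PiM A (\<lambda>_. gauss 0 \<sigma>))"
      by (rule LIMSEQ_offset)
  qed
qed

end
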